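(* If $m,n$ are numerals, $p\in\{0,1,2,3\}$, and $m',n'$ are terms such that $\vdash m=m'$ and $\vdash n=n'$, then $\vdash [mp+n]=m'\cdot p+n'$.
   Context: $\texttt{set.mm}$ is the Metamath database formalizing mathematics in ZFC set theory. Its terms include the constants $0$ and $1$, the operations $+$ and $\cdot$, and the defined constants $2:=1+1$, $3:=2+1$, $4:=3+1$, $\dots$, $10:=9+1$; every term is interpreted by its usual value. $\vdash\varphi$ means $\varphi$ is provable in this formal system. A numeral is a term defined recursively by: the terms $0,1,2,3$ are numerals; if $n$ is a numeral with nonzero value and $a\in\{0,1,2,3\}$, then the term $(4\cdot n)+a$ is a numeral. For an expression $x$ with nonnegative integer value, $[x]$ denotes the unique numeral whose value equals the value of $x$ (its base-4 representation). *)

theory Defs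
  imports Main
begin

section \<open>Metamath formal systems\<close>

text \<open>
  The definitions follow the set-theoretic description of formal systems in the appendix of the
  Metamath book: expressions are a typecode followed by a string of symbols, there are infinitely
  many variables of each type, axiomatic statements carry distinct-variable restrictions, and
  a proof may use dummy variables with restrictions of their own.
\<close>

datatype typecode = Wff | Setvar | Class | Provable

datatype mvar = WffVar nat | SetVar nat | ClassVar nat

fun var_type :: "mvar \<Rightarrow> typecode" where
  "var_type (WffVar i) = Wff"
| "var_type (SetVar i) = Setvar"
| "var_type (ClassVar i) = Class"

datatype sym = C string | X mvar

type_synonym expr = "typecode \<times> sym list"

definition str_vars :: "sym list \<Rightarrow> mvar set" where
  "str_vars s = {v. X v \<in> set s}"

definition expr_vars :: "expr \<Rightarrow> mvar set" where
  "expr_vars e = str_vars (snd e)"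

fun subst_sym :: "(mvar \<Rightarrow> sym list) \<Rightarrow> sym \<Rightarrow> sym list" where
  "subst_sym \<sigma> (C c) = [C c]"
| "subst_sym \<sigma> (X v) = \<sigma> v"

definition subst_expr :: "(mvar \<Rightarrow> sym list) \<Rightarrow> expr \<Rightarrow> expr" where
  "subst_expr \<sigma> e = (fst e, concat (map (subst_sym \<sigma>) (snd e)))"

text \<open>
  An assertion consists of its distinct-variable restrictions (a set of unordered pairs), its
  essential hypotheses and its conclusion. The floating hypotheses (one for each variable that
  occurs) are left implicit.
\<close>

datatype assertion =
  Assertion (disj: "mvar set set") (hyps: "expr list") (concl: expr)

definition assertion_vars :: "assertion \<Rightarrow> mvar set" where
  "assertion_vars a = expr_vars (concl a) \<union> (\<Union>h \<in> set (hyps a). expr_vars h)"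

inductive derivable :: "assertion set \<Rightarrow> mvar set set \<Rightarrow> expr \<Rightarrow> bool"
  for \<Gamma> :: "assertion set" and D :: "mvar set set" where
  floating: "derivable \<Gamma> D (var_type v, [X v])"
| application:
    "\<lbrakk> a \<in> \<Gamma>;
       \<And>v. v \<in> assertion_vars a \<Longrightarrow> derivable \<Gamma> D (var_type v, \<sigma> v);
       \<And>h. h \<in> set (hyps a) \<Longrightarrow> derivable \<Gamma> D (subst_expr \<sigma> h);
       \<And>u v x y. \<lbrakk> {u, v} \<in> disj a; u \<noteq> v; x \<in> str_vars (\<sigma> u); y \<in> str_vars (\<sigma> v) \<rbrakk>
          \<Longrightarrow> x \<noteq> y \<and> {x, y} \<in> D \<rbrakk>
     \<Longrightarrow> derivable \<Gamma> D (subst_expr \<sigma> (concl a))"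

text \<open>
  Provability of \<open>e\<close> (without essential hypotheses) subject to the distinct-variable restrictions
  \<open>dv\<close>. Restrictions that involve a variable not occurring in \<open>e\<close> concern dummy variables
  of the proof, and are not part of the statement that is proved.
\<close>

definition provable :: "assertion set \<Rightarrow> mvar set set \<Rightarrow> expr \<Rightarrow> bool" where
  "provable \<Gamma> dv e \<longleftrightarrow>
     (\<exists>D. derivable \<Gamma> D e \<and>
          (\<forall>x \<in> expr_vars e. \<forall>y \<in> expr_vars e. x \<noteq> y \<longrightarrow> {x, y} \<in> D \<longrightarrow> {x, y} \<in> dv))"

text \<open>A term is an expression of type \<open>class\<close>; being a term is a matter of syntax alone.\<close>

definition is_term :: "assertion set \<Rightarrow> sym list \<Rightarrow> bool" where
  "is_term \<Gamma> t \<longleftrightarrow> derivable \<Gamma> {} (Class, t)"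


section \<open>Reading assertions from their ASCII source\<close>

fun tokens_aux :: "string \<Rightarrow> string \<Rightarrow> string list" where
  "tokens_aux acc [] = (if acc = [] then [] else [rev acc])"
| "tokens_aux acc (c # cs) =
     (if c = CHR '' '' then (if acc = [] then tokens_aux [] cs else rev acc # tokens_aux [] cs)
      else tokens_aux (c # acc) cs)"

definition tokens :: "string \<Rightarrow> string list" where
  "tokens s = tokens_aux [] s"

definition var_names :: "(string \<times> mvar) list" where
  "var_names =
     [(''ph'', WffVar 0), (''ps'', WffVar 1), (''ch'', WffVar 2),
      (''x'', SetVar 0), (''y'', SetVar 1), (''z'', SetVar 2), (''w'', SetVar 3),
      (''v'', SetVar 4), (''u'', SetVar 5), (''t'', SetVar 6),
      (''A'', ClassVar 0), (''B'', ClassVar 1), (''C'', ClassVar 2),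
      (''F'', ClassVar 3), (''R'', ClassVar 4)]"

definition read_sym :: "string \<Rightarrow> sym" where
  "read_sym s = (case map_of var_names s of Some v \<Rightarrow> X v | None \<Rightarrow> C s)"

definition read_typecode :: "string \<Rightarrow> typecode" where
  "read_typecode s =
     (if s = ''wff'' then Wff else if s = ''setvar'' then Setvar
      else if s = ''class'' then Class else Provable)"

definition read_expr :: "string \<Rightarrow> expr" where
  "read_expr s = (read_typecode (hd (tokens s)), map read_sym (tl (tokens s)))"

text \<open>As in a \<open>$d\<close> statement, a group of variables stands for all pairs of distinct members.\<close>

definition disj_group :: "string \<Rightarrow> mvar set set" where
  "disj_group s =
     {{u, v} | u v. u \<in> str_vars (map read_sym (tokens s)) \<and>
                    v \<in> str_vars (map read_sym (tokens s)) \<and> u \<noteq> v}"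

definition rule :: "string list \<Rightarrow> string list \<Rightarrow> string \<Rightarrow> assertion" where
  "rule ds hs c = Assertion (\<Union>d \<in> set ds. disj_group d) (map read_expr hs) (read_expr c)"

definition axm :: "string list \<Rightarrow> string \<Rightarrow> assertion" where
  "axm ds c = rule ds [] c"


section \<open>The base of set.mm\<close>

text \<open>
  The lists below are the \<open>$a\<close> statements of set.mm (in the form of 2015, when \<open>10\<close> was still a
  defined constant) for classical predicate calculus with equality, ZFC, class terms,
  operation values, complex numbers and the constants \<open>2\<close>, ..., \<open>10\<close>. The names of the
  corresponding set.mm statements are given where they are not evident. In set.mm the complex number
  axioms are themselves \<open>$a\<close> statements (each one preceded by a proof of the same fact from the
  construction of the complex numbers in ZFC).

  Since a backslash cannot occur in a string literal, the three set.mm constants that contain one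
  are renamed: \<open>and\<close> and \<open>or\<close> are the two binary connectives, and \<open>setminus\<close> is the
  difference of classes.
\<close>

definition logic_syntax :: "assertion list" where
  "logic_syntax = map (axm [])
     [''wff -. ph'',
      ''wff ( ph -> ps )'',
      ''wff ( ph <-> ps )'',
      ''wff ( ph or ps )'',
      ''wff ( ph and ps )'',
      ''wff ( ph and ps and ch )'',
      ''wff A. x ph'',
      ''wff E. x ph'',
      ''wff [ y / x ] ph'',
      ''class x'',
      ''wff A = B'',
      ''wff A e. B'']"

definition class_syntax :: "assertion list" where
  "class_syntax = map (axm [])
     [''class { x | ph }'',
      ''wff A =/= B'',
      ''wff A. x e. A ph'',
      ''wff E. x e. A ph'',
      ''class _V'',
      ''class ( A setminus B )'',
      ''class ( A u. B )'',
      ''class ( A i^i B )'',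
      ''wff A C_ B'',
      ''class (/)'',
      ''class { A }'',
      ''class { A , B }'',
      ''class <. A , B >.'',
      ''class U. A'',
      ''wff A R B'',
      ''class ( iota x ph )'',
      ''class ( F ` A )'',
      ''class ( A F B )'']"

definition number_syntax :: "assertion list" where
  "number_syntax = map (axm [])
     [''class CC'', ''class RR'', ''class 0'', ''class 1'', ''class _i'',
      ''class +'', ''class <RR'', ''class x.'',
      ''class 2'', ''class 3'', ''class 4'', ''class 5'', ''class 6'',
      ''class 7'', ''class 8'', ''class 9'', ''class 10'']"

definition propositional_axioms :: "assertion list" where
  "propositional_axioms =
     [rule [] [''|- ph'', ''|- ( ph -> ps )''] ''|- ps'',
      axm [] ''|- ( ph -> ( ps -> ph ) )'',
      axm [] ''|- ( ( ph -> ( ps -> ch ) ) -> ( ( ph -> ps ) -> ( ph -> ch ) ) )'',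
      axm [] ''|- ( ( -. ph -> -. ps ) -> ( ps -> ph ) )'',
      \<comment> \<open>df-bi, df-or, df-an, df-3an\<close>
      axm [] ''|- -. ( ( ( ph <-> ps ) -> -. ( ( ph -> ps ) -> -. ( ps -> ph ) ) ) -> -. ( -. ( ( ph -> ps ) -> -. ( ps -> ph ) ) -> ( ph <-> ps ) ) )'',
      axm [] ''|- ( ( ph or ps ) <-> ( -. ph -> ps ) )'',
      axm [] ''|- ( ( ph and ps ) <-> -. ( ph -> -. ps ) )'',
      axm [] ''|- ( ( ph and ps and ch ) <-> ( ( ph and ps ) and ch ) )'']"

definition predicate_axioms :: "assertion list" where
  "predicate_axioms =
     [\<comment> \<open>ax-gen, ax-4, ..., ax-13 (in the numbering used since May 2015)\<close>
      rule [] [''|- ph''] ''|- A. x ph'',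
      axm [] ''|- ( A. x ( ph -> ps ) -> ( A. x ph -> A. x ps ) )'',
      axm [''x ph''] ''|- ( ph -> A. x ph )'',
      axm [] ''|- -. A. x -. x = y'',
      axm [] ''|- ( x = y -> ( x = z -> y = z ) )'',
      axm [] ''|- ( x = y -> ( x e. z -> y e. z ) )'',
      axm [] ''|- ( x = y -> ( z e. x -> z e. y ) )'',
      axm [] ''|- ( -. A. x ph -> A. x -. A. x ph )'',
      axm [] ''|- ( A. x A. y ph -> A. y A. x ph )'',
      axm [] ''|- ( x = y -> ( A. y ph -> A. x ( x = y -> ph ) ) )'',
      axm [] ''|- ( -. x = y -> ( y = z -> A. x y = z ) )'',
      \<comment> \<open>df-ex, df-sb\<close>
      axm [] ''|- ( E. x ph <-> -. A. x -. ph )'',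
      axm [] ''|- ( [ y / x ] ph <-> ( ( x = y -> ph ) and E. x ( x = y and ph ) ) )'']"

definition set_axioms :: "assertion list" where
  "set_axioms =
     [\<comment> \<open>ax-ext, ax-rep, ax-pow, ax-un, ax-reg, ax-inf, ax-ac\<close>
      axm [''x y z''] ''|- ( A. z ( z e. x <-> z e. y ) -> x = y )'',
      axm [''x y z w'']
        ''|- ( A. w E. y A. z ( A. y ph -> z = y ) -> E. y A. z ( z e. y <-> E. w ( w e. x and A. y ph ) ) )'',
      axm [''x y z w''] ''|- E. y A. z ( A. w ( w e. z -> w e. x ) -> z e. y )'',
      axm [''x y z w''] ''|- E. y A. z ( E. w ( z e. w and w e. x ) -> z e. y )'',
      axm [''x y z''] ''|- ( E. y y e. x -> E. y ( y e. x and A. z ( z e. y -> -. z e. x ) ) )'',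
      axm [''x y z w''] ''|- E. y ( x e. y and A. z ( z e. y -> E. w ( z e. w and w e. y ) ) )'',
      axm [''x y z w v u t'']
        ''|- E. y A. z A. w ( ( z e. w and w e. x ) -> E. v A. u ( E. t ( ( u e. w and w e. t ) and ( u e. t and t e. y ) ) <-> u = v ) )'']"

definition class_axioms :: "assertion list" where
  "class_axioms =
     [\<comment> \<open>df-clab, df-cleq, df-clel\<close>
      axm [] ''|- ( x e. { y | ph } <-> [ x / y ] ph )'',
      rule [''x A'', ''x B'', ''x y z'']
        [''|- ( A. x ( x e. y <-> x e. z ) -> y = z )'']
        ''|- ( A = B <-> A. x ( x e. A <-> x e. B ) )'',
      axm [''x A'', ''x B''] ''|- ( A e. B <-> E. x ( x = A and x e. B ) )'',
      axm [] ''|- ( A =/= B <-> -. A = B )'',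
      axm [] ''|- ( A. x e. A ph <-> A. x ( x e. A -> ph ) )'',
      axm [] ''|- ( E. x e. A ph <-> E. x ( x e. A and ph ) )'',
      axm [] ''|- _V = { x | x = x }'',
      axm [''x A'', ''x B''] ''|- ( A setminus B ) = { x | ( x e. A and -. x e. B ) }'',
      axm [''x A'', ''x B''] ''|- ( A u. B ) = { x | ( x e. A or x e. B ) }'',
      axm [''x A'', ''x B''] ''|- ( A i^i B ) = { x | ( x e. A and x e. B ) }'',
      axm [] ''|- ( A C_ B <-> ( A i^i B ) = A )'',
      axm [] ''|- (/) = ( _V setminus _V )'',
      axm [''x A''] ''|- { A } = { x | x = A }'',
      axm [] ''|- { A , B } = ( { A } u. { B } )'',
      axm [''x A'', ''x B'']
        ''|- <. A , B >. = { x | ( A e. _V and B e. _V and x e. { { A } , { A , B } } ) }'',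
      axm [''x y A''] ''|- U. A = { x | E. y ( x e. y and y e. A ) }'',
      axm [] ''|- ( A R B <-> <. A , B >. e. R )'',
      axm [''x y'', ''y ph''] ''|- ( iota x ph ) = U. { y | { x | ph } = { y } }'',
      \<comment> \<open>df-fv, df-ov\<close>
      axm [''x A'', ''x F''] ''|- ( F ` A ) = ( iota x A F x )'',
      axm [] ''|- ( A F B ) = ( F ` <. A , B >. )'']"

definition number_axioms :: "assertion list" where
  "number_axioms =
     [axm [] ''|- CC e. _V'',
      axm [] ''|- RR C_ CC'',
      axm [] ''|- 1 e. CC'',
      axm [] ''|- _i e. CC'',
      axm [] ''|- ( ( A e. CC and B e. CC ) -> ( A + B ) e. CC )'',
      axm [] ''|- ( ( A e. RR and B e. RR ) -> ( A + B ) e. RR )'',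
      axm [] ''|- ( ( A e. CC and B e. CC ) -> ( A x. B ) e. CC )'',
      axm [] ''|- ( ( A e. RR and B e. RR ) -> ( A x. B ) e. RR )'',
      axm [] ''|- ( ( A e. CC and B e. CC ) -> ( A x. B ) = ( B x. A ) )'',
      axm [] ''|- ( ( A e. CC and B e. CC and C e. CC ) -> ( ( A + B ) + C ) = ( A + ( B + C ) ) )'',
      axm [] ''|- ( ( A e. CC and B e. CC and C e. CC ) -> ( ( A x. B ) x. C ) = ( A x. ( B x. C ) ) )'',
      axm [] ''|- ( ( A e. CC and B e. CC and C e. CC ) -> ( A x. ( B + C ) ) = ( ( A x. B ) + ( A x. C ) ) )'',
      axm [] ''|- ( ( _i x. _i ) + 1 ) = 0'',
      axm [] ''|- 1 =/= 0'',
      axm [] ''|- ( A e. RR -> ( A x. 1 ) = A )'',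
      axm [''x A''] ''|- ( A e. RR -> E. x e. RR ( A + x ) = 0 )'',
      axm [''x A''] ''|- ( ( A e. RR and A =/= 0 ) -> E. x e. RR ( A x. x ) = 1 )'',
      axm [''x y A''] ''|- ( A e. CC -> E. x e. RR E. y e. RR A = ( x + ( _i x. y ) ) )'',
      axm [] ''|- ( ( A e. RR and B e. RR ) -> ( A <RR B <-> -. ( A = B or B <RR A ) ) )'',
      axm [] ''|- ( ( A e. RR and B e. RR and C e. RR ) -> ( ( A <RR B and B <RR C ) -> A <RR C ) )'',
      axm [] ''|- ( ( A e. RR and B e. RR and C e. RR ) -> ( A <RR B -> ( C + A ) <RR ( C + B ) ) )'',
      axm [] ''|- ( ( A e. RR and B e. RR ) -> ( ( 0 <RR A and 0 <RR B ) -> 0 <RR ( A x. B ) ) )'',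
      axm [''x y z A'']
        ''|- ( ( A C_ RR and A =/= (/) and E. x e. RR A. y e. A y <RR x ) -> E. x e. RR ( A. y e. A -. x <RR y and A. y e. RR ( y <RR x -> E. z e. A y <RR z ) ) )'',
      axm [] ''|- 2 = ( 1 + 1 )'',
      axm [] ''|- 3 = ( 2 + 1 )'',
      axm [] ''|- 4 = ( 3 + 1 )'',
      axm [] ''|- 5 = ( 4 + 1 )'',
      axm [] ''|- 6 = ( 5 + 1 )'',
      axm [] ''|- 7 = ( 6 + 1 )'',
      axm [] ''|- 8 = ( 7 + 1 )'',
      axm [] ''|- 9 = ( 8 + 1 )'',
      axm [] ''|- 10 = ( 9 + 1 )'']"

definition set_mm_base :: "assertion set" where
  "set_mm_base = set (logic_syntax @ class_syntax @ number_syntax @ propositional_axioms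
     @ predicate_axioms @ set_axioms @ class_axioms @ number_axioms)"

text \<open>
  Beyond this base, set.mm has many more \<open>$a\<close> statements (further definitions, including the
  construction of the complex numbers), whose constants may also occur in terms. A
  version of set.mm is therefore taken to be any database that contains the base.
\<close>

definition set_mm_database :: "assertion set \<Rightarrow> bool" where
  "set_mm_database \<Gamma> \<longleftrightarrow> set_mm_base \<subseteq> \<Gamma>"


section \<open>Arithmetic terms and numerals\<close>

definition eq_thm :: "sym list \<Rightarrow> sym list \<Rightarrow> expr" where
  "eq_thm s t = (Provable, s @ [C ''=''] @ t)"

definition plus_str :: "sym list \<Rightarrow> sym list \<Rightarrow> sym list" where
  "plus_str s t = [C ''(''] @ s @ [C ''+''] @ t @ [C '')'']"

definition times_str :: "sym list \<Rightarrow> sym list \<Rightarrow> sym list" where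
  "times_str s t = [C ''(''] @ s @ [C ''x.''] @ t @ [C '')'']"

datatype arith_term =
    Zero | One | Two | Three | Four | Five | Six | Seven | Eight | Nine | Ten
  | Plus arith_term arith_term | Times arith_term arith_term

fun term_str :: "arith_term \<Rightarrow> sym list" where
  "term_str Zero = [C ''0'']"
| "term_str One = [C ''1'']"
| "term_str Two = [C ''2'']"
| "term_str Three = [C ''3'']"
| "term_str Four = [C ''4'']"
| "term_str Five = [C ''5'']"
| "term_str Six = [C ''6'']"
| "term_str Seven = [C ''7'']"
| "term_str Eight = [C ''8'']"
| "term_str Nine = [C ''9'']"
| "term_str Ten = [C ''10'']"
| "term_str (Plus s t) = plus_str (term_str s) (term_str t)"
| "term_str (Times s t) = times_str (term_str s) (term_str t)"

fun val :: "arith_term \<Rightarrow> nat" where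
  "val Zero = 0"
| "val One = 1"
| "val Two = 2"
| "val Three = 3"
| "val Four = 4"
| "val Five = 5"
| "val Six = 6"
| "val Seven = 7"
| "val Eight = 8"
| "val Nine = 9"
| "val Ten = 10"
| "val (Plus s t) = val s + val t"
| "val (Times s t) = val s * val t"

inductive numeral_term :: "arith_term \<Rightarrow> bool" where
  digit: "a \<in> {Zero, One, Two, Three} \<Longrightarrow> numeral_term a"
| step: "\<lbrakk> numeral_term n; val n \<noteq> 0; a \<in> {Zero, One, Two, Three} \<rbrakk>
     \<Longrightarrow> numeral_term (Plus (Times Four n) a)"

definition numeral_of :: "arith_term \<Rightarrow> arith_term" where
  "numeral_of x = (THE t. numeral_term t \<and> val t = val x)"

end

theory Submission
  imports Defs
begin

text \<open>
  Every arithmetic term is provably equal to a sum \<open>((0 + 1) + ...) + 1\<close>, so two such terms are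
  provably equal as soon as they have the same value; the equations for \<open>m'\<close> and \<open>n'\<close> then enter
  by congruence of the operation value \<open>( A F B )\<close>, which goes down through the definitions of
  \<open>( A F B )\<close>, \<open>( F ` A )\<close>, \<open>iota\<close> and ordered pairs to the definition of class equality.

  Inside set.mm one argues semantically: by Lindenbaum's lemma a formula is a theorem once it is true
  in every valuation that respects the propositional connectives and makes all theorems true. The
  terms modulo provable equality in such a valuation form an algebra with partial ring axioms and
  an order, in which the missing laws for \<open>0\<close> (and \<open>1 \<in> RR\<close>) are derived. Quantifiers only
  occur as eigenvariables.
\<close>

section \<open>Renaming of variables in derivations\<close>

text \<open>The number axioms say little about \<open>0\<close>: they assert neither its neutrality
  nor its membership in \<open>RR\<close>, nor that \<open>1\<close> is real. Addition is not
  assumed commutative, and negatives are given on the right only. Three sources fill the gap.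
  Trichotomy and monotonicity of the order give left cancellation on \<open>RR\<close>. The
  reciprocal axiom turns a hypothetical nonzero value into an equation about \<open>1\<close>. The
  equation for the square of \<open>_i\<close> excludes \<open>1 + 1 = 1\<close> and supplies a left
  negative of \<open>1\<close>. Only the laws that evaluate sums and products of sums of
  \<open>1\<close> are derived; commutativity of addition of natural numbers then comes from
  comparing values.

  The other obstacle is the distinct-variable restrictions: \<open>m'\<close> and \<open>n'\<close>
  are arbitrary class terms. They are kept as opaque atoms, and all set variables of the argument
  receive indices beyond those occurring in them, so that these variables can always serve as
  dummies.\<close>

lemma str_vars_simps [simp]:
  "str_vars [] = {}" "str_vars (C c # s) = str_vars s" "str_vars (X v # s) = insert v (str_vars s)"
  "str_vars (s @ t) = str_vars s \<union> str_vars t"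
  by (auto simp: str_vars_def)

lemma subst_expr_rename:
  "subst_expr \<rho> (subst_expr \<sigma> e) = subst_expr (\<lambda>v. concat (map (subst_sym \<rho>) (\<sigma> v))) e"
proof -
  have "concat (map (subst_sym \<rho>) (concat (map (subst_sym \<sigma>) s))) =
      concat (map (subst_sym (\<lambda>v. concat (map (subst_sym \<rho>) (\<sigma> v)))) s)" for s
  proof (induction s)
    case (Cons a s)
    then show ?case by (cases a) auto
  qed simp
  then show ?thesis by (simp add: subst_expr_def)
qed

lemma subst_expr_fixed:
  assumes "\<And>v. v \<in> expr_vars e \<Longrightarrow> \<sigma> v = [X v]"
  shows "subst_expr \<sigma> e = e"
proof -
  have "(\<And>v. v \<in> str_vars s \<Longrightarrow> \<sigma> v = [X v]) \<Longrightarrow> concat (map (subst_sym \<sigma>) s) = s" for s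
  proof (induction s)
    case (Cons a s)
    then show ?case by (cases a) (auto simp: str_vars_def)
  qed simp
  with assms show ?thesis by (cases e) (simp add: subst_expr_def expr_vars_def)
qed

lemma str_vars_rename:
  "str_vars (concat (map (subst_sym (\<lambda>v. [X (\<rho> v)])) s)) = \<rho> ` str_vars s"
proof (induction s)
  case (Cons a s)
  then show ?case by (cases a) (auto simp: str_vars_def)
qed (simp add: str_vars_def)

text \<open>The substitution of each application is composed with \<open>\<rho>\<close>. Injectivity
  keeps distinct variables distinct, and the last hypothesis supplies the image of every restriction
  that a step relies on.\<close>

lemma derivable_rename:
  assumes "derivable \<Gamma> D e" and "inj \<rho>" and "\<And>v. var_type (\<rho> v) = var_type v"
    and "\<And>d. d \<in> D \<Longrightarrow> \<rho> ` d \<in> D'"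
  shows "derivable \<Gamma> D' (subst_expr (\<lambda>v. [X (\<rho> v)]) e)"
  using assms(1)
proof induction
  case (floating v)
  show ?case
    using derivable.floating[of \<Gamma> D' "\<rho> v"] by (simp add: subst_expr_def assms(3))
next
  case (application a \<sigma>)
  let ?\<tau> = "\<lambda>v. concat (map (subst_sym (\<lambda>v. [X (\<rho> v)])) (\<sigma> v))"
  have "derivable \<Gamma> D' (subst_expr ?\<tau> (concl a))"
  proof (rule derivable.application)
    fix v assume "v \<in> assertion_vars a"
    from application.IH(1)[OF this] show "derivable \<Gamma> D' (var_type v, ?\<tau> v)"
      by (simp add: subst_expr_def)
  next
    fix h assume "h \<in> set (hyps a)"
    from application.IH(2)[OF this] show "derivable \<Gamma> D' (subst_expr ?\<tau> h)"
      by (simp add: subst_expr_rename)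
  next
    fix u v x y
    assume uv: "{u, v} \<in> disj a" "u \<noteq> v" and "x \<in> str_vars (?\<tau> u)" "y \<in> str_vars (?\<tau> v)"
    then obtain x' y' where xy: "x = \<rho> x'" "y = \<rho> y'" "x' \<in> str_vars (\<sigma> u)" "y' \<in> str_vars (\<sigma> v)"
      by (auto simp: str_vars_rename)
    then have "x' \<noteq> y'" "{x', y'} \<in> D"
      using application.hyps uv by blast+
    with assms(4)[of "{x', y'}"] xy show "x \<noteq> y \<and> {x, y} \<in> D'"
      using injD[OF assms(2)] by auto
  qed (fact application.hyps)
  then show ?case by (simp add: subst_expr_rename)
qed

lemma derivable_mono:
  assumes "derivable \<Gamma> D e" and "D \<subseteq> D'"
  shows "derivable \<Gamma> D' e"
  using derivable_rename[OF assms(1), of id D'] assms(2) by (auto simp: subst_expr_fixed)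

section \<open>An embedded language of set.mm\<close>

datatype const = KUniv | KCC | KRR | KZero | KOne | KI | KPlus | KLess | KTimes
  | KTwo | KThree | KFour | KFive | KSix | KSeven | KEight | KNine | KTen

primrec const_str :: "const \<Rightarrow> string" where
  "const_str KUniv = ''_V''"
| "const_str KCC = ''CC''"
| "const_str KRR = ''RR''"
| "const_str KZero = ''0''"
| "const_str KOne = ''1''"
| "const_str KI = ''_i''"
| "const_str KPlus = ''+''"
| "const_str KLess = ''<RR''"
| "const_str KTimes = ''x.''"
| "const_str KTwo = ''2''"
| "const_str KThree = ''3''"
| "const_str KFour = ''4''"
| "const_str KFive = ''5''"
| "const_str KSix = ''6''"
| "const_str KSeven = ''7''"
| "const_str KEight = ''8''"
| "const_str KNine = ''9''"
| "const_str KTen = ''10''"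

text \<open>\<open>Atom\<close> stands for the two given class terms, whose syntax is unknown
  because the database may contain further constants. All variables of the language proper are set
  variables; schematic letters are handled by quantification in HOL.\<close>

datatype trm = Var nat | Atom bool | Cst const | Abs nat fm | Union trm trm | Inter trm trm | Sing trm
  | Pair trm trm | OPair trm trm | BigU trm | Iota nat fm | App trm trm | Opv trm trm trm
and fm = Neg fm | Imp fm fm | Bi fm fm | Or fm fm | And fm fm | And3 fm fm fm
  | All nat fm | Ex nat fm | Sb nat nat fm | Eq trm trm | El trm trm | Ne trm trm | Sub trm trm
  | Rex nat trm fm | Rel trm trm trm

text \<open>Bound variables are included, since a distinct-variable restriction concerns occurrence
  in the string and not freeness.\<close>

primrec tvars :: "trm \<Rightarrow> nat set" and fvars :: "fm \<Rightarrow> nat set" where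
  "tvars (Var x) = {x}"
| "tvars (Atom b) = {}"
| "tvars (Cst k) = {}"
| "tvars (Abs x p) = insert x (fvars p)"
| "tvars (Union a b) = tvars a \<union> tvars b"
| "tvars (Inter a b) = tvars a \<union> tvars b"
| "tvars (Sing a) = tvars a"
| "tvars (Pair a b) = tvars a \<union> tvars b"
| "tvars (OPair a b) = tvars a \<union> tvars b"
| "tvars (BigU a) = tvars a"
| "tvars (Iota x p) = insert x (fvars p)"
| "tvars (App f a) = tvars f \<union> tvars a"
| "tvars (Opv a f b) = tvars a \<union> tvars f \<union> tvars b"
| "fvars (Neg p) = fvars p"
| "fvars (Imp p q) = fvars p \<union> fvars q"
| "fvars (Bi p q) = fvars p \<union> fvars q"
| "fvars (Or p q) = fvars p \<union> fvars q"
| "fvars (And p q) = fvars p \<union> fvars q"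
| "fvars (And3 p q r) = fvars p \<union> fvars q \<union> fvars r"
| "fvars (All x p) = insert x (fvars p)"
| "fvars (Ex x p) = insert x (fvars p)"
| "fvars (Sb y x p) = insert y (insert x (fvars p))"
| "fvars (Eq a b) = tvars a \<union> tvars b"
| "fvars (El a b) = tvars a \<union> tvars b"
| "fvars (Ne a b) = tvars a \<union> tvars b"
| "fvars (Sub a b) = tvars a \<union> tvars b"
| "fvars (Rex x a p) = insert x (tvars a \<union> fvars p)"
| "fvars (Rel a r b) = tvars a \<union> tvars r \<union> tvars b"

lemma finite_vars: "finite (tvars a)" "finite (fvars p)"
  by (induction a and p) auto

lemma disj_group_iff:
  "{u, v} \<in> disj_group s \<and> u \<noteq> v \<longleftrightarrow>
    u \<in> str_vars (map read_sym (tokens s)) \<and> v \<in> str_vars (map read_sym (tokens s)) \<and> u \<noteq> v"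
  by (auto simp: disj_group_def doubleton_eq_iff)

text \<open>
  The object variable \<open>x\<close> of the embedded language is the set variable with index \<open>N + x\<close>; the
  condition on \<open>D\<close> makes it available as a dummy variable.
\<close>

locale embedding =
  fixes \<Gamma> :: "assertion set" and D :: "mvar set set" and N :: nat and atom :: "bool \<Rightarrow> sym list"
  assumes base: "set_mm_base \<subseteq> \<Gamma>"
    and atom_class: "\<And>b. derivable \<Gamma> D (Class, atom b)"
    and atom_vars: "\<And>b x. SetVar (N + x) \<notin> str_vars (atom b)"
    and dummy: "\<And>x v. v \<noteq> SetVar (N + x) \<Longrightarrow> {SetVar (N + x), v} \<in> D"
begin

abbreviation ov :: "nat \<Rightarrow> sym list" where "ov x \<equiv> [X (SetVar (N + x))]"

primrec tstr :: "trm \<Rightarrow> sym list" and fstr :: "fm \<Rightarrow> sym list" where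
  "tstr (Var x) = ov x"
| "tstr (Atom b) = atom b"
| "tstr (Cst k) = [C (const_str k)]"
| "tstr (Abs x p) = [C ''{''] @ ov x @ [C ''|''] @ fstr p @ [C ''}'']"
| "tstr (Union a b) = [C ''(''] @ tstr a @ [C ''u.''] @ tstr b @ [C '')'']"
| "tstr (Inter a b) = [C ''(''] @ tstr a @ [C ''i^i''] @ tstr b @ [C '')'']"
| "tstr (Sing a) = [C ''{''] @ tstr a @ [C ''}'']"
| "tstr (Pair a b) = [C ''{''] @ tstr a @ [C '',''] @ tstr b @ [C ''}'']"
| "tstr (OPair a b) = [C ''<.''] @ tstr a @ [C '',''] @ tstr b @ [C ''>.'']"
| "tstr (BigU a) = [C ''U.''] @ tstr a"
| "tstr (Iota x p) = [C ''('', C ''iota''] @ ov x @ fstr p @ [C '')'']"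
| "tstr (App f a) = [C ''(''] @ tstr f @ [C ''`''] @ tstr a @ [C '')'']"
| "tstr (Opv a f b) = [C ''(''] @ tstr a @ tstr f @ tstr b @ [C '')'']"
| "fstr (Neg p) = [C ''-.''] @ fstr p"
| "fstr (Imp p q) = [C ''(''] @ fstr p @ [C ''->''] @ fstr q @ [C '')'']"
| "fstr (Bi p q) = [C ''(''] @ fstr p @ [C ''<->''] @ fstr q @ [C '')'']"
| "fstr (Or p q) = [C ''(''] @ fstr p @ [C ''or''] @ fstr q @ [C '')'']"
| "fstr (And p q) = [C ''(''] @ fstr p @ [C ''and''] @ fstr q @ [C '')'']"
| "fstr (And3 p q r) =
     [C ''(''] @ fstr p @ [C ''and''] @ fstr q @ [C ''and''] @ fstr r @ [C '')'']"
| "fstr (All x p) = [C ''A.''] @ ov x @ fstr p"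
| "fstr (Ex x p) = [C ''E.''] @ ov x @ fstr p"
| "fstr (Sb y x p) = [C ''[''] @ ov y @ [C ''/''] @ ov x @ [C '']''] @ fstr p"
| "fstr (Eq a b) = tstr a @ [C ''=''] @ tstr b"
| "fstr (El a b) = tstr a @ [C ''e.''] @ tstr b"
| "fstr (Ne a b) = tstr a @ [C ''=/=''] @ tstr b"
| "fstr (Sub a b) = tstr a @ [C ''C_''] @ tstr b"
| "fstr (Rex x a p) = [C ''E.''] @ ov x @ [C ''e.''] @ tstr a @ fstr p"
| "fstr (Rel a r b) = tstr a @ tstr r @ tstr b"

text \<open>
  Metavariables beyond the end of the lists are left alone, so that every value of \<open>inst\<close> is
  derivable.
\<close>

definition inst :: "fm list \<Rightarrow> nat list \<Rightarrow> trm list \<Rightarrow> mvar \<Rightarrow> sym list" where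
  "inst P V T v =
     (case v of
        WffVar i \<Rightarrow> if i < length P then fstr (P ! i) else [X v]
      | SetVar i \<Rightarrow> if i < length V then ov (V ! i) else [X v]
      | ClassVar i \<Rightarrow> if i < length T then tstr (T ! i) else [X v])"

lemma dummy_vars:
  "SetVar (N + x) \<in> str_vars (tstr a) \<longleftrightarrow> x \<in> tvars a"
  "SetVar (N + x) \<in> str_vars (fstr p) \<longleftrightarrow> x \<in> fvars p"
  by (induction a and p) (auto simp: atom_vars)

text \<open>A condition on embedded syntax that guarantees a restriction between \<open>u\<close>
  and \<open>v\<close> after instantiation. Every restricted pair in the base contains a set
  variable, so it suffices to treat a set variable in first position and to allow the arguments to
  be swapped where this is used.\<close>

definition indep :: "fm list \<Rightarrow> nat list \<Rightarrow> trm list \<Rightarrow> mvar \<Rightarrow> mvar \<Rightarrow> bool" where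
  "indep P V T u v \<longleftrightarrow>
     (case u of
        SetVar i \<Rightarrow> i < length V \<and>
          (case v of
             SetVar j \<Rightarrow> j < length V \<and> V ! i \<noteq> V ! j
           | ClassVar j \<Rightarrow> j < length T \<and> V ! i \<notin> tvars (T ! j)
           | WffVar j \<Rightarrow> j < length P \<and> V ! i \<notin> fvars (P ! j))
      | _ \<Rightarrow> False)"

text \<open>The value of \<open>u\<close> is a single dummy variable, which \<open>dummy\<close>
  pairs in \<open>D\<close> with every other variable. Only the inequality remains to be
  checked.\<close>

lemma indep_distinct:
  assumes "indep P V T u v" and "x \<in> str_vars (inst P V T u)" and "y \<in> str_vars (inst P V T v)"
  shows "x \<noteq> y \<and> {x, y} \<in> D"
proof (cases u)
  case (SetVar i)
  then have i: "i < length V" and x: "x = SetVar (N + V ! i)"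
    using assms(1,2) by (auto simp: inst_def indep_def)
  have "y \<noteq> x"
    using assms unfolding indep_def SetVar x by (cases v) (auto simp: inst_def dummy_vars)
  with x show ?thesis using dummy by blast
qed (use assms in \<open>auto simp: indep_def\<close>)

lemma derivable_inst:
  assumes "rule ds hs c \<in> set_mm_base"
    and "\<And>p. p \<in> set P \<Longrightarrow> derivable \<Gamma> D (Wff, fstr p)"
    and "\<And>t. t \<in> set T \<Longrightarrow> derivable \<Gamma> D (Class, tstr t)"
    and "\<And>h. h \<in> set hs \<Longrightarrow> derivable \<Gamma> D (subst_expr (inst P V T) (read_expr h))"
    and "\<And>d u v. \<lbrakk>d \<in> set ds; u \<in> str_vars (map read_sym (tokens d));
           v \<in> str_vars (map read_sym (tokens d)); u \<noteq> v\<rbrakk> \<Longrightarrow> indep P V T u v \<or> indep P V T v u"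
  shows "derivable \<Gamma> D (subst_expr (inst P V T) (read_expr c))"
proof -
  let ?a = "rule ds hs c"
  have "derivable \<Gamma> D (subst_expr (inst P V T) (concl ?a))"
  proof (rule derivable.application)
    show "?a \<in> \<Gamma>" using assms(1) base by blast
  next
    fix v
    show "derivable \<Gamma> D (var_type v, inst P V T v)"
      using assms(2,3) derivable.floating[of \<Gamma> D]
        derivable.floating[of \<Gamma> D "WffVar _"] derivable.floating[of \<Gamma> D "SetVar _"]
        derivable.floating[of \<Gamma> D "ClassVar _"]
      by (cases v) (auto simp: inst_def)
  next
    fix h assume "h \<in> set (hyps ?a)"
    then show "derivable \<Gamma> D (subst_expr (inst P V T) h)"
      using assms(4) by (auto simp: rule_def)
  next
    fix u v x y
    assume "{u, v} \<in> disj ?a" and uv: "u \<noteq> v"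
      and xy: "x \<in> str_vars (inst P V T u)" "y \<in> str_vars (inst P V T v)"
    then obtain d where "d \<in> set ds" "{u, v} \<in> disj_group d"
      by (auto simp: rule_def)
    with assms(5) uv disj_group_iff have "indep P V T u v \<or> indep P V T v u" by metis
    with xy indep_distinct show "x \<noteq> y \<and> {x, y} \<in> D"
      by (metis insert_commute)
  qed
  then show ?thesis by (simp add: rule_def)
qed

lemmas base_defs = set_mm_base_def logic_syntax_def class_syntax_def number_syntax_def
  propositional_axioms_def predicate_axioms_def set_axioms_def class_axioms_def number_axioms_def

lemmas parse_simps = read_expr_def read_typecode_def tokens_def read_sym_def var_names_def
  subst_expr_def inst_def

lemma derivable_axm:
  assumes "axm ds c \<in> set_mm_base"
    and "subst_expr (inst P V T) (read_expr c) = e"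
    and "\<And>p. p \<in> set P \<Longrightarrow> derivable \<Gamma> D (Wff, fstr p)"
    and "\<And>t. t \<in> set T \<Longrightarrow> derivable \<Gamma> D (Class, tstr t)"
    and "\<And>d u v. \<lbrakk>d \<in> set ds; u \<in> str_vars (map read_sym (tokens d));
           v \<in> str_vars (map read_sym (tokens d)); u \<noteq> v\<rbrakk> \<Longrightarrow> indep P V T u v \<or> indep P V T v u"
  shows "derivable \<Gamma> D e"
  using derivable_inst[where hs = "[]" and c = c and P = P and V = V and T = T] assms by (simp add: axm_def)

lemma derivable_syntax:
  assumes "axm [] c \<in> set_mm_base"
    and "subst_expr (inst P V T) (read_expr c) = e"
    and "\<And>p. p \<in> set P \<Longrightarrow> derivable \<Gamma> D (Wff, fstr p)"
    and "\<And>t. t \<in> set T \<Longrightarrow> derivable \<Gamma> D (Class, tstr t)"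
  shows "derivable \<Gamma> D e"
  using assms by (rule derivable_axm) auto

lemma derivable_Cst: "derivable \<Gamma> D (Class, tstr (Cst k))"
  by (rule derivable_syntax[where c = "''class '' @ const_str k" and P = "[]" and V = "[]" and T = "[]"];
      cases k; simp add: base_defs parse_simps)

text \<open>Metavariables are looked up by index: \<open>F\<close> is class variable 3 and
  \<open>R\<close> is class variable 4. This is why the lists for \<open>App\<close>,
  \<open>Opv\<close> and \<open>Rel\<close> are padded with repeated terms.\<close>

lemma derivable_wff: "derivable \<Gamma> D (Class, tstr a)" "derivable \<Gamma> D (Wff, fstr p)"
proof (induction a and p)
  case (Var x)
  show ?case
    by (rule derivable_syntax[where c = "''class x''"
        and P = "[]" and V = "[x]" and T = "[]"]) (auto simp: base_defs parse_simps)
next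
  case (Atom b)
  show ?case using atom_class by simp
next
  case (Cst k)
  show ?case by (rule derivable_Cst)
next
  case (Abs x p)
  show ?case
    by (rule derivable_syntax[where c = "''class { x | ph }''"
        and P = "[p]" and V = "[x]" and T = "[]"]) (use Abs in \<open>auto simp: base_defs parse_simps\<close>)
next
  case (Union a b)
  show ?case
    by (rule derivable_syntax[where c = "''class ( A u. B )''"
        and P = "[]" and V = "[0]" and T = "[a, b]"]) (use Union in \<open>auto simp: base_defs parse_simps\<close>)
next
  case (Inter a b)
  show ?case
    by (rule derivable_syntax[where c = "''class ( A i^i B )''"
        and P = "[]" and V = "[0]" and T = "[a, b]"]) (use Inter in \<open>auto simp: base_defs parse_simps\<close>)
next
  case (Sing a)
  show ?case
    by (rule derivable_syntax[where c = "''class { A }''"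
        and P = "[]" and V = "[0]" and T = "[a]"]) (use Sing in \<open>auto simp: base_defs parse_simps\<close>)
next
  case (Pair a b)
  show ?case
    by (rule derivable_syntax[where c = "''class { A , B }''"
        and P = "[]" and V = "[0]" and T = "[a, b]"]) (use Pair in \<open>auto simp: base_defs parse_simps\<close>)
next
  case (OPair a b)
  show ?case
    by (rule derivable_syntax[where c = "''class <. A , B >.''"
        and P = "[]" and V = "[0]" and T = "[a, b]"]) (use OPair in \<open>auto simp: base_defs parse_simps\<close>)
next
  case (BigU a)
  show ?case
    by (rule derivable_syntax[where c = "''class U. A''"
        and P = "[]" and V = "[0]" and T = "[a]"]) (use BigU in \<open>auto simp: base_defs parse_simps\<close>)
next
  case (Iota x p)
  show ?case
    by (rule derivable_syntax[where c = "''class ( iota x ph )''"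
        and P = "[p]" and V = "[x]" and T = "[]"]) (use Iota in \<open>auto simp: base_defs parse_simps\<close>)
next
  case (App f a)
  show ?case
    by (rule derivable_syntax[where c = "''class ( F ` A )''"
        and P = "[]" and V = "[0]" and T = "[a, a, a, f]"]) (use App in \<open>auto simp: base_defs parse_simps\<close>)
next
  case (Opv a f b)
  show ?case
    by (rule derivable_syntax[where c = "''class ( A F B )''"
        and P = "[]" and V = "[0]" and T = "[a, b, a, f]"]) (use Opv in \<open>auto simp: base_defs parse_simps\<close>)
next
  case (Neg p)
  show ?case
    by (rule derivable_syntax[where c = "''wff -. ph''"
        and P = "[p]" and V = "[0]" and T = "[]"]) (use Neg in \<open>auto simp: base_defs parse_simps\<close>)
next
  case (Imp p q)
  show ?case
    by (rule derivable_syntax[where c = "''wff ( ph -> ps )''"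
        and P = "[p, q]" and V = "[0]" and T = "[]"]) (use Imp in \<open>auto simp: base_defs parse_simps\<close>)
next
  case (Bi p q)
  show ?case
    by (rule derivable_syntax[where c = "''wff ( ph <-> ps )''"
        and P = "[p, q]" and V = "[0]" and T = "[]"]) (use Bi in \<open>auto simp: base_defs parse_simps\<close>)
next
  case (Or p q)
  show ?case
    by (rule derivable_syntax[where c = "''wff ( ph or ps )''"
        and P = "[p, q]" and V = "[0]" and T = "[]"]) (use Or in \<open>auto simp: base_defs parse_simps\<close>)
next
  case (And p q)
  show ?case
    by (rule derivable_syntax[where c = "''wff ( ph and ps )''"
        and P = "[p, q]" and V = "[0]" and T = "[]"]) (use And in \<open>auto simp: base_defs parse_simps\<close>)
next
  case (And3 p q r)
  show ?case
    by (rule derivable_syntax[where c = "''wff ( ph and ps and ch )''"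
        and P = "[p, q, r]" and V = "[0]" and T = "[]"]) (use And3 in \<open>auto simp: base_defs parse_simps\<close>)
next
  case (All x p)
  show ?case
    by (rule derivable_syntax[where c = "''wff A. x ph''"
        and P = "[p]" and V = "[x]" and T = "[]"]) (use All in \<open>auto simp: base_defs parse_simps\<close>)
next
  case (Ex x p)
  show ?case
    by (rule derivable_syntax[where c = "''wff E. x ph''"
        and P = "[p]" and V = "[x]" and T = "[]"]) (use Ex in \<open>auto simp: base_defs parse_simps\<close>)
next
  case (Sb y x p)
  show ?case
    by (rule derivable_syntax[where c = "''wff [ y / x ] ph''"
        and P = "[p]" and V = "[x, y]" and T = "[]"]) (use Sb in \<open>auto simp: base_defs parse_simps\<close>)
next
  case (Eq a b)
  show ?case
    by (rule derivable_syntax[where c = "''wff A = B''"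
        and P = "[]" and V = "[0]" and T = "[a, b]"]) (use Eq in \<open>auto simp: base_defs parse_simps\<close>)
next
  case (El a b)
  show ?case
    by (rule derivable_syntax[where c = "''wff A e. B''"
        and P = "[]" and V = "[0]" and T = "[a, b]"]) (use El in \<open>auto simp: base_defs parse_simps\<close>)
next
  case (Ne a b)
  show ?case
    by (rule derivable_syntax[where c = "''wff A =/= B''"
        and P = "[]" and V = "[0]" and T = "[a, b]"]) (use Ne in \<open>auto simp: base_defs parse_simps\<close>)
next
  case (Sub a b)
  show ?case
    by (rule derivable_syntax[where c = "''wff A C_ B''"
        and P = "[]" and V = "[0]" and T = "[a, b]"]) (use Sub in \<open>auto simp: base_defs parse_simps\<close>)
next
  case (Rex x a p)
  show ?case
    by (rule derivable_syntax[where c = "''wff E. x e. A ph''"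
        and P = "[p]" and V = "[x]" and T = "[a]"]) (use Rex in \<open>auto simp: base_defs parse_simps\<close>)
next
  case (Rel a r b)
  show ?case
    by (rule derivable_syntax[where c = "''wff A R B''"
        and P = "[]" and V = "[0]" and T = "[a, b, a, a, r]"]) (use Rel in \<open>auto simp: base_defs parse_simps\<close>)
qed

section \<open>Theorems and axioms\<close>

definition proves :: "fm \<Rightarrow> bool" where
  "proves p \<longleftrightarrow> derivable \<Gamma> D (Provable, fstr p)"

lemma proves_axm:
  assumes "axm ds c \<in> set_mm_base"
    and "subst_expr (inst P V T) (read_expr c) = (Provable, fstr p)"
    and "\<And>d u v. \<lbrakk>d \<in> set ds; u \<in> str_vars (map read_sym (tokens d));
           v \<in> str_vars (map read_sym (tokens d)); u \<noteq> v\<rbrakk> \<Longrightarrow> indep P V T u v \<or> indep P V T v u"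
  shows "proves p"
  unfolding proves_def by (rule derivable_axm[OF assms(1,2) _ _ assms(3)]) (rule derivable_wff)+

lemma proves_mp:
  assumes "proves (Imp p q)" and "proves p"
  shows "proves q"
proof -
  have "derivable \<Gamma> D (subst_expr (inst [p, q] [] []) (read_expr ''|- ps''))"
  proof (rule derivable_inst[where ds = "[]" and hs = "[''|- ph'', ''|- ( ph -> ps )'']"])
    show "rule [] [''|- ph'', ''|- ( ph -> ps )''] ''|- ps'' \<in> set_mm_base"
      by (simp add: base_defs)
    show "derivable \<Gamma> D (subst_expr (inst [p, q] [] []) (read_expr h))"
      if "h \<in> set [''|- ph'', ''|- ( ph -> ps )'']" for h
      using that assms by (auto simp: proves_def parse_simps)
  qed (auto intro: derivable_wff)
  then show ?thesis by (simp add: proves_def parse_simps)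
qed

lemma proves_gen:
  assumes "proves p"
  shows "proves (All x p)"
proof -
  have "derivable \<Gamma> D (subst_expr (inst [p] [x] []) (read_expr ''|- A. x ph''))"
  proof (rule derivable_inst[where ds = "[]" and hs = "[''|- ph'']"])
    show "rule [] [''|- ph''] ''|- A. x ph'' \<in> set_mm_base"
      by (simp add: base_defs)
    show "derivable \<Gamma> D (subst_expr (inst [p] [x] []) (read_expr h))" if "h \<in> set [''|- ph'']" for h
      using that assms by (auto simp: proves_def parse_simps)
  qed (auto intro: derivable_wff)
  then show ?thesis by (simp add: proves_def parse_simps)
qed

section \<open>Instances of the axioms of logic and of the definitions of class terms\<close>

lemma prop_K:
  "proves (Imp p (Imp q p))"
  by (rule proves_axm[where ds = "[]" and c = "''|- ( ph -> ( ps -> ph ) )''"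
        and P = "[p, q]" and V = "[]" and T = "[]"])
    (simp_all add: base_defs parse_simps)

lemma prop_S:
  "proves (Imp (Imp p (Imp q r)) (Imp (Imp p q) (Imp p r)))"
  by (rule proves_axm[where ds = "[]"
        and c = "''|- ( ( ph -> ( ps -> ch ) ) -> ( ( ph -> ps ) -> ( ph -> ch ) ) )''"
        and P = "[p, q, r]" and V = "[]" and T = "[]"])
    (simp_all add: base_defs parse_simps)

lemma prop_contrapos:
  "proves (Imp (Imp (Neg p) (Neg q)) (Imp q p))"
  by (rule proves_axm[where ds = "[]" and c = "''|- ( ( -. ph -> -. ps ) -> ( ps -> ph ) )''"
        and P = "[p, q]" and V = "[]" and T = "[]"])
    (simp_all add: base_defs parse_simps)

lemma df_bi:
  "proves (Neg (Imp (Imp (Bi p q) (Neg (Imp (Imp p q) (Neg (Imp q p))))) (Neg (Imp (Neg (Imp (Imp p q) (Neg (Imp q p)))) (Bi p q)))))"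
  by (rule proves_axm[where ds = "[]"
        and c = "''|- -. ( ( ( ph <-> ps ) -> -. ( ( ph -> ps ) -> -. ( ps -> ph ) ) ) -> -. ( -. ( ( ph -> ps ) -> -. ( ps -> ph ) ) -> ( ph <-> ps ) ) )''"
        and P = "[p, q]" and V = "[]" and T = "[]"])
    (simp_all add: base_defs parse_simps)

lemma df_or:
  "proves (Bi (Or p q) (Imp (Neg p) q))"
  by (rule proves_axm[where ds = "[]" and c = "''|- ( ( ph or ps ) <-> ( -. ph -> ps ) )''"
        and P = "[p, q]" and V = "[]" and T = "[]"])
    (simp_all add: base_defs parse_simps)

lemma df_and:
  "proves (Bi (And p q) (Neg (Imp p (Neg q))))"
  by (rule proves_axm[where ds = "[]" and c = "''|- ( ( ph and ps ) <-> -. ( ph -> -. ps ) )''"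
        and P = "[p, q]" and V = "[]" and T = "[]"])
    (simp_all add: base_defs parse_simps)

lemma df_and3:
  "proves (Bi (And3 p q r) (And (And p q) r))"
  by (rule proves_axm[where ds = "[]"
        and c = "''|- ( ( ph and ps and ch ) <-> ( ( ph and ps ) and ch ) )''"
        and P = "[p, q, r]" and V = "[]" and T = "[]"])
    (simp_all add: base_defs parse_simps)

lemma all_distrib:
  "proves (Imp (All x (Imp p q)) (Imp (All x p) (All x q)))"
  by (rule proves_axm[where ds = "[]"
        and c = "''|- ( A. x ( ph -> ps ) -> ( A. x ph -> A. x ps ) )''"
        and P = "[p, q]" and V = "[x]" and T = "[]"])
    (simp_all add: base_defs parse_simps)

lemma all_vacuous:
  assumes "x \<notin> fvars p"
  shows "proves (Imp p (All x p))"
  by (rule proves_axm[where ds = "[''x ph'']" and c = "''|- ( ph -> A. x ph )''"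
        and P = "[p]" and V = "[x]" and T = "[]"])
    (use assms in \<open>auto simp: base_defs parse_simps indep_def\<close>)

lemma df_ex:
  "proves (Bi (Ex x p) (Neg (All x (Neg p))))"
  by (rule proves_axm[where ds = "[]" and c = "''|- ( E. x ph <-> -. A. x -. ph )''"
        and P = "[p]" and V = "[x]" and T = "[]"])
    (simp_all add: base_defs parse_simps)

lemma df_sb:
  "proves (Bi (Sb y x p) (And (Imp (Eq (Var x) (Var y)) p) (Ex x (And (Eq (Var x) (Var y)) p))))"
  by (rule proves_axm[where ds = "[]"
        and c = "''|- ( [ y / x ] ph <-> ( ( x = y -> ph ) and E. x ( x = y and ph ) ) )''"
        and P = "[p]" and V = "[x, y]" and T = "[]"])
    (simp_all add: base_defs parse_simps)

lemma ax_ext: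
  assumes "distinct [x, y, z]"
  shows "proves (Imp (All z (Bi (El (Var z) (Var x)) (El (Var z) (Var y)))) (Eq (Var x) (Var y)))"
  by (rule proves_axm[where ds = "[''x y z'']"
        and c = "''|- ( A. z ( z e. x <-> z e. y ) -> x = y )''"
        and P = "[]" and V = "[x, y, z]" and T = "[]"])
    (use assms in \<open>auto simp: base_defs parse_simps indep_def\<close>)

lemma df_clab:
  "proves (Bi (El (Var x) (Abs y p)) (Sb x y p))"
  by (rule proves_axm[where ds = "[]" and c = "''|- ( x e. { y | ph } <-> [ x / y ] ph )''"
        and P = "[p]" and V = "[x, y]" and T = "[]"])
    (simp_all add: base_defs parse_simps)

lemma df_clel:
  assumes "x \<notin> tvars a \<union> tvars b"
  shows "proves (Bi (El a b) (Ex x (And (Eq (Var x) a) (El (Var x) b))))"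
  by (rule proves_axm[where ds = "[''x A'', ''x B'']"
        and c = "''|- ( A e. B <-> E. x ( x = A and x e. B ) )''"
        and P = "[]" and V = "[x]" and T = "[a, b]"])
    (use assms in \<open>auto simp: base_defs parse_simps indep_def\<close>)

lemma df_ne:
  "proves (Bi (Ne a b) (Neg (Eq a b)))"
  by (rule proves_axm[where ds = "[]" and c = "''|- ( A =/= B <-> -. A = B )''"
        and P = "[]" and V = "[]" and T = "[a, b]"])
    (simp_all add: base_defs parse_simps)

lemma df_rex:
  "proves (Bi (Rex x a p) (Ex x (And (El (Var x) a) p)))"
  by (rule proves_axm[where ds = "[]" and c = "''|- ( E. x e. A ph <-> E. x ( x e. A and ph ) )''"
        and P = "[p]" and V = "[x]" and T = "[a]"])
    (simp_all add: base_defs parse_simps)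

lemma df_un:
  assumes "x \<notin> tvars a \<union> tvars b"
  shows "proves (Eq (Union a b) (Abs x (Or (El (Var x) a) (El (Var x) b))))"
  by (rule proves_axm[where ds = "[''x A'', ''x B'']"
        and c = "''|- ( A u. B ) = { x | ( x e. A or x e. B ) }''"
        and P = "[]" and V = "[x]" and T = "[a, b]"])
    (use assms in \<open>auto simp: base_defs parse_simps indep_def\<close>)

lemma df_sn:
  assumes "x \<notin> tvars a"
  shows "proves (Eq (Sing a) (Abs x (Eq (Var x) a)))"
  by (rule proves_axm[where ds = "[''x A'']" and c = "''|- { A } = { x | x = A }''"
        and P = "[]" and V = "[x]" and T = "[a]"])
    (use assms in \<open>auto simp: base_defs parse_simps indep_def\<close>)

lemma df_pr:
  "proves (Eq (Pair a b) (Union (Sing a) (Sing b)))"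
  by (rule proves_axm[where ds = "[]" and c = "''|- { A , B } = ( { A } u. { B } )''"
        and P = "[]" and V = "[]" and T = "[a, b]"])
    (simp_all add: base_defs parse_simps)

lemma df_op:
  assumes "x \<notin> tvars a \<union> tvars b"
  shows "proves (Eq (OPair a b) (Abs x
      (And3 (El a (Cst KUniv)) (El b (Cst KUniv)) (El (Var x) (Pair (Sing a) (Pair a b))))))"
  by (rule proves_axm[where ds = "[''x A'', ''x B'']"
        and c = "''|- <. A , B >. = { x | ( A e. _V and B e. _V and x e. { { A } , { A , B } } ) }''"
        and P = "[]" and V = "[x]" and T = "[a, b]"])
    (use assms in \<open>auto simp: base_defs parse_simps indep_def\<close>)

lemma df_uni:
  assumes "x \<noteq> y" and "x \<notin> tvars a" and "y \<notin> tvars a"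
  shows "proves (Eq (BigU a) (Abs x (Ex y (And (El (Var x) (Var y)) (El (Var y) a)))))"
  by (rule proves_axm[where ds = "[''x y A'']"
        and c = "''|- U. A = { x | E. y ( x e. y and y e. A ) }''"
        and P = "[]" and V = "[x, y]" and T = "[a]"])
    (use assms in \<open>auto simp: base_defs parse_simps indep_def\<close>)

lemma df_br:
  "proves (Bi (Rel a r b) (El (OPair a b) r))"
  by (rule proves_axm[where ds = "[]" and c = "''|- ( A R B <-> <. A , B >. e. R )''"
        and P = "[]" and V = "[]" and T = "[a, b, c, f, r]"])
    (simp_all add: base_defs parse_simps)

lemma df_iota:
  assumes "x \<noteq> y" and "y \<notin> fvars p"
  shows "proves (Eq (Iota x p) (BigU (Abs y (Eq (Abs x p) (Sing (Var y))))))"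
  by (rule proves_axm[where ds = "[''x y'', ''y ph'']"
        and c = "''|- ( iota x ph ) = U. { y | { x | ph } = { y } }''"
        and P = "[p]" and V = "[x, y]" and T = "[]"])
    (use assms in \<open>auto simp: base_defs parse_simps indep_def\<close>)

lemma df_fv:
  assumes "x \<notin> tvars a" and "x \<notin> tvars f"
  shows "proves (Eq (App f a) (Iota x (Rel a f (Var x))))"
  by (rule proves_axm[where ds = "[''x A'', ''x F'']" and c = "''|- ( F ` A ) = ( iota x A F x )''"
        and P = "[]" and V = "[x]" and T = "[a, b, c, f]"])
    (use assms in \<open>auto simp: base_defs parse_simps indep_def\<close>)

lemma df_ov:
  "proves (Eq (Opv a f b) (App f (OPair a b)))"
  by (rule proves_axm[where ds = "[]" and c = "''|- ( A F B ) = ( F ` <. A , B >. )''"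
        and P = "[]" and V = "[]" and T = "[a, b, c, f]"])
    (simp_all add: base_defs parse_simps)

section \<open>Instances of the number axioms and of the inclusion of \<open>RR\<close> in
  \<open>CC\<close>\<close>

lemma one_cn:
  "proves (El (Cst KOne) (Cst KCC))"
  by (rule proves_axm[where ds = "[]" and c = "''|- 1 e. CC''"
        and P = "[]" and V = "[]" and T = "[]"])
    (simp_all add: base_defs parse_simps)

lemma i_cn:
  "proves (El (Cst KI) (Cst KCC))"
  by (rule proves_axm[where ds = "[]" and c = "''|- _i e. CC''"
        and P = "[]" and V = "[]" and T = "[]"])
    (simp_all add: base_defs parse_simps)

lemma df_in:
  assumes "x \<notin> tvars a \<union> tvars b"
  shows "proves (Eq (Inter a b) (Abs x (And (El (Var x) a) (El (Var x) b))))"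
  by (rule proves_axm[where ds = "[''x A'', ''x B'']"
        and c = "''|- ( A i^i B ) = { x | ( x e. A and x e. B ) }''"
        and P = "[]" and V = "[x]" and T = "[a, b]"])
    (use assms in \<open>auto simp: base_defs parse_simps indep_def\<close>)

lemma df_ss:
  "proves (Bi (Sub a b) (Eq (Inter a b) a))"
  by (rule proves_axm[where ds = "[]" and c = "''|- ( A C_ B <-> ( A i^i B ) = A )''"
        and P = "[]" and V = "[]" and T = "[a, b]"])
    (simp_all add: base_defs parse_simps)

lemma re_sub_cn:
  "proves (Sub (Cst KRR) (Cst KCC))"
  by (rule proves_axm[where ds = "[]" and c = "''|- RR C_ CC''"
        and P = "[]" and V = "[]" and T = "[]"])
    (simp_all add: base_defs parse_simps)

lemma add_cn:
  "proves (Imp (And (El a (Cst KCC)) (El b (Cst KCC))) (El (Opv a (Cst KPlus) b) (Cst KCC)))"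
  by (rule proves_axm[where ds = "[]"
        and c = "''|- ( ( A e. CC and B e. CC ) -> ( A + B ) e. CC )''"
        and P = "[]" and V = "[]" and T = "[a, b]"])
    (simp_all add: base_defs parse_simps)

lemma add_re:
  "proves (Imp (And (El a (Cst KRR)) (El b (Cst KRR))) (El (Opv a (Cst KPlus) b) (Cst KRR)))"
  by (rule proves_axm[where ds = "[]"
        and c = "''|- ( ( A e. RR and B e. RR ) -> ( A + B ) e. RR )''"
        and P = "[]" and V = "[]" and T = "[a, b]"])
    (simp_all add: base_defs parse_simps)

lemma mul_cn:
  "proves (Imp (And (El a (Cst KCC)) (El b (Cst KCC))) (El (Opv a (Cst KTimes) b) (Cst KCC)))"
  by (rule proves_axm[where ds = "[]"
        and c = "''|- ( ( A e. CC and B e. CC ) -> ( A x. B ) e. CC )''"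
        and P = "[]" and V = "[]" and T = "[a, b]"])
    (simp_all add: base_defs parse_simps)

lemma mul_re:
  "proves (Imp (And (El a (Cst KRR)) (El b (Cst KRR))) (El (Opv a (Cst KTimes) b) (Cst KRR)))"
  by (rule proves_axm[where ds = "[]"
        and c = "''|- ( ( A e. RR and B e. RR ) -> ( A x. B ) e. RR )''"
        and P = "[]" and V = "[]" and T = "[a, b]"])
    (simp_all add: base_defs parse_simps)

lemma mul_comm:
  "proves (Imp (And (El a (Cst KCC)) (El b (Cst KCC)))
    (Eq (Opv a (Cst KTimes) b) (Opv b (Cst KTimes) a)))"
  by (rule proves_axm[where ds = "[]"
        and c = "''|- ( ( A e. CC and B e. CC ) -> ( A x. B ) = ( B x. A ) )''"
        and P = "[]" and V = "[]" and T = "[a, b]"])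
    (simp_all add: base_defs parse_simps)

lemma add_assoc:
  "proves (Imp (And3 (El a (Cst KCC)) (El b (Cst KCC)) (El c (Cst KCC)))
    (Eq (Opv (Opv a (Cst KPlus) b) (Cst KPlus) c) (Opv a (Cst KPlus) (Opv b (Cst KPlus) c))))"
  by (rule proves_axm[where ds = "[]"
        and c = "''|- ( ( A e. CC and B e. CC and C e. CC ) -> ( ( A + B ) + C ) = ( A + ( B + C ) ) )''"
        and P = "[]" and V = "[]" and T = "[a, b, c]"])
    (simp_all add: base_defs parse_simps)

lemma distrib:
  "proves (Imp (And3 (El a (Cst KCC)) (El b (Cst KCC)) (El c (Cst KCC)))
    (Eq (Opv a (Cst KTimes) (Opv b (Cst KPlus) c)) (Opv (Opv a (Cst KTimes) b) (Cst KPlus) (Opv a (Cst KTimes) c))))"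
  by (rule proves_axm[where ds = "[]"
        and c = "''|- ( ( A e. CC and B e. CC and C e. CC ) -> ( A x. ( B + C ) ) = ( ( A x. B ) + ( A x. C ) ) )''"
        and P = "[]" and V = "[]" and T = "[a, b, c]"])
    (simp_all add: base_defs parse_simps)

lemma i_square:
  "proves (Eq (Opv (Opv (Cst KI) (Cst KTimes) (Cst KI)) (Cst KPlus) (Cst KOne)) (Cst KZero))"
  by (rule proves_axm[where ds = "[]" and c = "''|- ( ( _i x. _i ) + 1 ) = 0''"
        and P = "[]" and V = "[]" and T = "[]"])
    (simp_all add: base_defs parse_simps)

lemma one_ne_zero:
  "proves (Ne (Cst KOne) (Cst KZero))"
  by (rule proves_axm[where ds = "[]" and c = "''|- 1 =/= 0''"
        and P = "[]" and V = "[]" and T = "[]"])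
    (simp_all add: base_defs parse_simps)

lemma mul_one:
  "proves (Imp (El a (Cst KRR)) (Eq (Opv a (Cst KTimes) (Cst KOne)) a))"
  by (rule proves_axm[where ds = "[]" and c = "''|- ( A e. RR -> ( A x. 1 ) = A )''"
        and P = "[]" and V = "[]" and T = "[a]"])
    (simp_all add: base_defs parse_simps)

lemma ex_neg:
  assumes "x \<notin> tvars a"
  shows "proves (Imp (El a (Cst KRR))
    (Rex x (Cst KRR) (Eq (Opv a (Cst KPlus) (Var x)) (Cst KZero))))"
  by (rule proves_axm[where ds = "[''x A'']"
        and c = "''|- ( A e. RR -> E. x e. RR ( A + x ) = 0 )''"
        and P = "[]" and V = "[x]" and T = "[a]"])
    (use assms in \<open>auto simp: base_defs parse_simps indep_def\<close>)

lemma ex_recip: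
  assumes "x \<notin> tvars a"
  shows "proves (Imp (And (El a (Cst KRR)) (Ne a (Cst KZero)))
    (Rex x (Cst KRR) (Eq (Opv a (Cst KTimes) (Var x)) (Cst KOne))))"
  by (rule proves_axm[where ds = "[''x A'']"
        and c = "''|- ( ( A e. RR and A =/= 0 ) -> E. x e. RR ( A x. x ) = 1 )''"
        and P = "[]" and V = "[x]" and T = "[a]"])
    (use assms in \<open>auto simp: base_defs parse_simps indep_def\<close>)

lemma cn_decomp:
  assumes "x \<noteq> y" and "x \<notin> tvars a" and "y \<notin> tvars a"
  shows "proves (Imp (El a (Cst KCC))
    (Rex x (Cst KRR) (Rex y (Cst KRR) (Eq a (Opv (Var x) (Cst KPlus) (Opv (Cst KI) (Cst KTimes) (Var y)))))))"
  by (rule proves_axm[where ds = "[''x y A'']"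
        and c = "''|- ( A e. CC -> E. x e. RR E. y e. RR A = ( x + ( _i x. y ) ) )''"
        and P = "[]" and V = "[x, y]" and T = "[a]"])
    (use assms in \<open>auto simp: base_defs parse_simps indep_def\<close>)

lemma less_trichotomy:
  "proves (Imp (And (El a (Cst KRR)) (El b (Cst KRR)))
    (Bi (Rel a (Cst KLess) b) (Neg (Or (Eq a b) (Rel b (Cst KLess) a)))))"
  by (rule proves_axm[where ds = "[]"
        and c = "''|- ( ( A e. RR and B e. RR ) -> ( A <RR B <-> -. ( A = B or B <RR A ) ) )''"
        and P = "[]" and V = "[]" and T = "[a, b]"])
    (simp_all add: base_defs parse_simps)

lemma less_add:
  "proves (Imp (And3 (El a (Cst KRR)) (El b (Cst KRR)) (El c (Cst KRR)))
    (Imp (Rel a (Cst KLess) b) (Rel (Opv c (Cst KPlus) a) (Cst KLess) (Opv c (Cst KPlus) b))))"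
  by (rule proves_axm[where ds = "[]"
        and c = "''|- ( ( A e. RR and B e. RR and C e. RR ) -> ( A <RR B -> ( C + A ) <RR ( C + B ) ) )''"
        and P = "[]" and V = "[]" and T = "[a, b, c]"])
    (simp_all add: base_defs parse_simps)

lemma df_two:
  "proves (Eq (Cst KTwo) (Opv (Cst KOne) (Cst KPlus) (Cst KOne)))"
  by (rule proves_axm[where ds = "[]" and c = "''|- 2 = ( 1 + 1 )''"
        and P = "[]" and V = "[]" and T = "[]"])
    (simp_all add: base_defs parse_simps)

lemma df_three:
  "proves (Eq (Cst KThree) (Opv (Cst KTwo) (Cst KPlus) (Cst KOne)))"
  by (rule proves_axm[where ds = "[]" and c = "''|- 3 = ( 2 + 1 )''"
        and P = "[]" and V = "[]" and T = "[]"])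
    (simp_all add: base_defs parse_simps)

lemma df_four:
  "proves (Eq (Cst KFour) (Opv (Cst KThree) (Cst KPlus) (Cst KOne)))"
  by (rule proves_axm[where ds = "[]" and c = "''|- 4 = ( 3 + 1 )''"
        and P = "[]" and V = "[]" and T = "[]"])
    (simp_all add: base_defs parse_simps)

lemma df_five:
  "proves (Eq (Cst KFive) (Opv (Cst KFour) (Cst KPlus) (Cst KOne)))"
  by (rule proves_axm[where ds = "[]" and c = "''|- 5 = ( 4 + 1 )''"
        and P = "[]" and V = "[]" and T = "[]"])
    (simp_all add: base_defs parse_simps)

lemma df_six:
  "proves (Eq (Cst KSix) (Opv (Cst KFive) (Cst KPlus) (Cst KOne)))"
  by (rule proves_axm[where ds = "[]" and c = "''|- 6 = ( 5 + 1 )''"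
        and P = "[]" and V = "[]" and T = "[]"])
    (simp_all add: base_defs parse_simps)

lemma df_seven:
  "proves (Eq (Cst KSeven) (Opv (Cst KSix) (Cst KPlus) (Cst KOne)))"
  by (rule proves_axm[where ds = "[]" and c = "''|- 7 = ( 6 + 1 )''"
        and P = "[]" and V = "[]" and T = "[]"])
    (simp_all add: base_defs parse_simps)

lemma df_eight:
  "proves (Eq (Cst KEight) (Opv (Cst KSeven) (Cst KPlus) (Cst KOne)))"
  by (rule proves_axm[where ds = "[]" and c = "''|- 8 = ( 7 + 1 )''"
        and P = "[]" and V = "[]" and T = "[]"])
    (simp_all add: base_defs parse_simps)

lemma df_nine:
  "proves (Eq (Cst KNine) (Opv (Cst KEight) (Cst KPlus) (Cst KOne)))"
  by (rule proves_axm[where ds = "[]" and c = "''|- 9 = ( 8 + 1 )''"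
        and P = "[]" and V = "[]" and T = "[]"])
    (simp_all add: base_defs parse_simps)

lemma df_ten:
  "proves (Eq (Cst KTen) (Opv (Cst KNine) (Cst KPlus) (Cst KOne)))"
  by (rule proves_axm[where ds = "[]" and c = "''|- 10 = ( 9 + 1 )''"
        and P = "[]" and V = "[]" and T = "[]"])
    (simp_all add: base_defs parse_simps)

lemma df_cleq:
  assumes "x \<notin> tvars a" and "x \<notin> tvars b"
  shows "proves (Bi (Eq a b) (All x (Bi (El (Var x) a) (El (Var x) b))))"
proof -
  \<comment> \<open>The two further variables occur only in the essential hypothesis, which is an
    instance of extensionality. They must differ from \<open>x\<close> and from each other, but may
    occur in \<open>a\<close> and \<open>b\<close>.\<close>
  let ?\<sigma> = "inst [] [x, Suc x, Suc (Suc x)] [a, b]"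
  let ?c = "''|- ( A = B <-> A. x ( x e. A <-> x e. B ) )''"
  let ?hs = "[''|- ( A. x ( x e. y <-> x e. z ) -> y = z )'']"
  have "derivable \<Gamma> D (subst_expr ?\<sigma> (read_expr ?c))"
  proof (rule derivable_inst[where ds = "[''x A'', ''x B'', ''x y z'']" and hs = ?hs])
    show "rule [''x A'', ''x B'', ''x y z''] ?hs ?c \<in> set_mm_base"
      by (simp add: base_defs)
    show "derivable \<Gamma> D (subst_expr ?\<sigma> (read_expr h))" if "h \<in> set ?hs" for h
      using that ax_ext[of "Suc x" "Suc (Suc x)" x] by (auto simp: proves_def parse_simps)
  qed (use assms in \<open>auto simp: parse_simps indep_def intro: derivable_wff\<close>)
  then show ?thesis by (simp add: proves_def parse_simps)
qed

section \<open>Lindenbaum's lemma\<close>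

text \<open>A theory in the propositional sense: it contains all theorems and is closed under
  detachment but not necessarily under generalization, so the deduction theorem holds without side
  conditions.\<close>

definition closed :: "fm set \<Rightarrow> bool" where
  "closed S \<longleftrightarrow> {p. proves p} \<subseteq> S \<and> (\<forall>p q. Imp p q \<in> S \<longrightarrow> p \<in> S \<longrightarrow> q \<in> S)"

lemma closed_proves: "closed S \<Longrightarrow> proves p \<Longrightarrow> p \<in> S"
  by (auto simp: closed_def)

lemma closed_mp: "closed S \<Longrightarrow> Imp p q \<in> S \<Longrightarrow> p \<in> S \<Longrightarrow> q \<in> S"
  by (auto simp: closed_def)

lemma closed_weaken: "closed S \<Longrightarrow> q \<in> S \<Longrightarrow> Imp p q \<in> S"
  by (meson closed_mp closed_proves prop_K)

lemma closed_refl: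
  assumes "closed S"
  shows "Imp p p \<in> S"
  using closed_mp[OF assms closed_mp[OF assms closed_proves[OF assms prop_S]]]
    closed_proves[OF assms prop_K] by metis

text \<open>Deduction theorem: \<open>{q. Imp p q \<in> S}\<close> is the theory \<open>S\<close>
  extended by \<open>p\<close>. Reasoning under an assumption becomes reasoning in another closed
  set; \<open>prop_S\<close> provides detachment there.\<close>

lemma closed_deduction: "closed S \<Longrightarrow> closed {q. Imp p q \<in> S}"
  unfolding closed_def mem_Collect_eq
  by (metis (no_types, lifting) closed_def closed_mp closed_proves closed_weaken mem_Collect_eq prop_S subsetI)

lemma closed_contra:
  assumes "closed S" and "Neg p \<in> S" and "p \<in> S"
  shows "q \<in> S"
  using assms by (meson closed_mp closed_proves closed_weaken prop_contrapos)

text \<open>Without a constant for falsity, an absurd assumption is one that implies every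
  \<open>q\<close>. Taking \<open>q\<close> to be the negation of a theorem, contraposition derives
  \<open>p\<close> from that theorem.\<close>

lemma closed_by_contradiction:
  assumes "closed S" and "\<And>q. Imp (Neg p) q \<in> S"
  shows "p \<in> S"
  using assms by (meson closed_mp closed_proves prop_contrapos prop_K)

lemma closed_dneg:
  assumes "closed S" and "Neg (Neg p) \<in> S"
  shows "p \<in> S"
proof (rule closed_by_contradiction[OF assms(1)])
  fix q
  show "Imp (Neg p) q \<in> S"
    using closed_contra[OF closed_deduction[OF assms(1), of "Neg p"], of "Neg p" q]
      closed_weaken[OF assms(1,2)] closed_refl[OF assms(1)] by simp
qed

lemma closed_negI:
  assumes "closed S" and "\<And>q. Imp p q \<in> S"
  shows "Neg p \<in> S"
proof (rule closed_by_contradiction[OF assms(1)])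
  fix q
  let ?S = "{q. Imp (Neg (Neg p)) q \<in> S}"
  have S: "closed ?S" by (rule closed_deduction[OF assms(1)])
  have "p \<in> ?S" by (rule closed_dneg[OF S]) (simp add: closed_refl[OF assms(1)])
  moreover have "Imp p q \<in> ?S" using closed_weaken[OF assms(1,2)] by simp
  ultimately have "q \<in> ?S" using closed_mp[OF S] by blast
  then show "Imp (Neg (Neg p)) q \<in> S" by simp
qed

lemma closed_cases:
  assumes S: "closed S" and "Imp p q \<in> S" and "Imp (Neg p) q \<in> S"
  shows "q \<in> S"
proof (rule closed_by_contradiction[OF S])
  fix r
  let ?S = "{r. Imp (Neg q) r \<in> S}"
  have S': "closed ?S" by (rule closed_deduction[OF S])
  have nq: "Neg q \<in> ?S" by (simp add: closed_refl[OF S])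
  have "Imp p s \<in> ?S" for s
  proof -
    have "closed {r. Imp p r \<in> ?S}" by (rule closed_deduction[OF S'])
    moreover have "q \<in> {r. Imp p r \<in> ?S}" using closed_weaken[OF S assms(2)] by simp
    moreover have "Neg q \<in> {r. Imp p r \<in> ?S}" using closed_weaken[OF S' nq] by simp
    ultimately have "s \<in> {r. Imp p r \<in> ?S}" using closed_contra by blast
    then show ?thesis by simp
  qed
  then have "Neg p \<in> ?S" by (rule closed_negI[OF S'])
  moreover have "Imp (Neg p) q \<in> ?S" using closed_weaken[OF S assms(3)] by simp
  ultimately have "q \<in> ?S" using closed_mp[OF S'] by blast
  then have "r \<in> ?S" using closed_contra[OF S' nq] by blast
  then show "Imp (Neg q) r \<in> S" by simp
qed

text \<open>Quantified formulas and equations are constrained only through the theorems. A true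
  \<open>Ex x p\<close> need not have a true instance, and truth is not preserved by
  generalization.\<close>

definition model :: "(fm \<Rightarrow> bool) \<Rightarrow> bool" where
  "model v \<longleftrightarrow> (\<forall>p. proves p \<longrightarrow> v p) \<and>
     (\<forall>p q. v (Imp p q) \<longleftrightarrow> (v p \<longrightarrow> v q)) \<and> (\<forall>p. v (Neg p) \<longleftrightarrow> \<not> v p)"

text \<open>Lindenbaum's lemma: a maximal closed set that avoids \<open>p\<close> is a model in which \<open>p\<close> fails.\<close>

lemma provesI:
  assumes "\<And>v. model v \<Longrightarrow> v p"
  shows "proves p"
proof (rule ccontr)
  assume p: "\<not> proves p"
  define A where "A = {S. closed S \<and> p \<notin> S}"
  have "{q. proves q} \<in> A"
    using p proves_mp by (auto simp: A_def closed_def)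
  moreover have "\<Union>C \<in> A" if "C \<noteq> {}" "subset.chain A C" for C
    unfolding A_def closed_def mem_Collect_eq
  proof (intro conjI allI impI)
    show "{q. proves q} \<subseteq> \<Union>C" "p \<notin> \<Union>C"
      using that by (fastforce simp: A_def closed_def subset_chain_def)+
    fix q r assume "Imp q r \<in> \<Union>C" "q \<in> \<Union>C"
    then obtain S T where ST: "S \<in> C" "Imp q r \<in> S" "T \<in> C" "q \<in> T" by blast
    then have "S \<subseteq> T \<or> T \<subseteq> S" "closed S" "closed T"
      using that(2) by (auto simp: subset_chain_def A_def)
    with ST show "r \<in> \<Union>C" by (meson UnionI closed_mp subsetD)
  qed
  ultimately obtain M where "M \<in> A" and max: "\<And>S. S \<in> A \<Longrightarrow> M \<subseteq> S \<Longrightarrow> S = M"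
    using subset_Zorn_nonempty[of A] by blast
  then have M: "closed M" and pM: "p \<notin> M" by (auto simp: A_def)
  \<comment> \<open>Otherwise the extension of \<open>M\<close> by \<open>q\<close> would still
    avoid \<open>p\<close>; by maximality it would equal \<open>M\<close>, although it contains
    \<open>q\<close>.\<close>
  have imp_p: "Imp q p \<in> M" if "q \<notin> M" for q
  proof (rule ccontr)
    assume "Imp q p \<notin> M"
    then have "{r. Imp q r \<in> M} \<in> A"
      using closed_deduction[OF M] by (simp add: A_def)
    moreover have "M \<subseteq> {r. Imp q r \<in> M}" using closed_weaken[OF M] by blast
    ultimately have "{r. Imp q r \<in> M} = M" by (rule max)
    moreover have "q \<in> {r. Imp q r \<in> M}" using closed_refl[OF M] by simp
    ultimately show False using that by simp
  qed
  \<comment> \<open>If neither \<open>q\<close> nor its negation belonged to \<open>M\<close>, both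
    would imply \<open>p\<close>, and a case distinction would put \<open>p\<close> into
    \<open>M\<close>.\<close>
  have neg: "Neg q \<in> M \<longleftrightarrow> q \<notin> M" for q
    using closed_contra[OF M] closed_cases[OF M] imp_p pM by metis
  have "Imp q r \<in> M \<longleftrightarrow> (q \<in> M \<longrightarrow> r \<in> M)" for q r
    using closed_mp[OF M, of q r] closed_weaken[OF M, of r q] neg[of q]
      closed_mp[OF M closed_proves[OF M prop_contrapos], of r q] closed_weaken[OF M, of "Neg q" "Neg r"]
    by blast
  then have "model (\<lambda>q. q \<in> M)"
    using neg closed_proves[OF M] by (simp add: model_def)
  with assms pM show False by blast
qed

lemma model_proves: "model v \<Longrightarrow> proves p \<Longrightarrow> v p"
  by (simp add: model_def)

lemma model_simps [simp]:
  assumes "model v"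
  shows "v (Imp p q) \<longleftrightarrow> (v p \<longrightarrow> v q)" "v (Neg p) \<longleftrightarrow> \<not> v p" "v (Bi p q) \<longleftrightarrow> (v p \<longleftrightarrow> v q)"
    "v (Or p q) \<longleftrightarrow> v p \<or> v q" "v (And p q) \<longleftrightarrow> v p \<and> v q" "v (And3 p q r) \<longleftrightarrow> v p \<and> v q \<and> v r"
    "v (Ne a b) \<longleftrightarrow> \<not> v (Eq a b)"
proof -
  show imp: "v (Imp p q) \<longleftrightarrow> (v p \<longrightarrow> v q)" and neg: "v (Neg p) \<longleftrightarrow> \<not> v p" for p q
    using assms by (simp_all add: model_def)
  show bi: "v (Bi p q) \<longleftrightarrow> (v p \<longleftrightarrow> v q)" for p q
    using model_proves[OF assms df_bi[of p q]] by (auto simp: imp neg)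
  show "v (Or p q) \<longleftrightarrow> v p \<or> v q"
    using model_proves[OF assms df_or[of p q]] by (auto simp: imp neg bi)
  show con: "v (And p q) \<longleftrightarrow> v p \<and> v q" for p q
    using model_proves[OF assms df_and[of p q]] by (auto simp: imp neg bi)
  show "v (And3 p q r) \<longleftrightarrow> v p \<and> v q \<and> v r"
    using model_proves[OF assms df_and3[of p q r]] by (auto simp: con bi)
  show "v (Ne a b) \<longleftrightarrow> \<not> v (Eq a b)"
    using model_proves[OF assms df_ne[of a b]] by (auto simp: bi neg)
qed

lemma model_Ex: "model v \<Longrightarrow> v (Ex x p) \<longleftrightarrow> \<not> v (All x (Neg p))"
  using model_proves[OF _ df_ex[of x p], of v] by simp

lemma model_all_mp: "model v \<Longrightarrow> v (All x (Imp p q)) \<Longrightarrow> v (All x p) \<Longrightarrow> v (All x q)"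
  using model_proves[OF _ all_distrib[of x p q], of v] by simp

text \<open>Generalization applies to theorems and not to formulas true in one valuation. Quantifier
  rules are therefore stated for \<open>proves\<close>, with the local assumptions gathered in a
  premise \<open>g\<close> that is free of \<open>x\<close>.\<close>

lemma all_intro:
  assumes "proves (Imp g p)" and "x \<notin> fvars g"
  shows "proves (Imp g (All x p))"
proof (rule provesI)
  fix v assume v: "model v"
  show "v (Imp g (All x p))"
    using model_all_mp[OF v model_proves[OF v proves_gen[OF assms(1)]]]
      model_proves[OF v all_vacuous[OF assms(2)]] v by simp
qed

lemma model_all_mono:
  assumes "model v" and "proves (Imp p q)" and "v (All x p)"
  shows "v (All x q)"
  using assms model_all_mp model_proves proves_gen by meson

lemma ex_mono:
  assumes "proves (Imp g (Imp p q))" and "x \<notin> fvars g"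
  shows "proves (Imp g (Imp (Ex x p) (Ex x q)))"
proof -
  have "proves (Imp g (Imp (Neg q) (Neg p)))"
    using model_proves[OF _ assms(1)] by (intro provesI) auto
  then have *: "proves (Imp g (All x (Imp (Neg q) (Neg p))))"
    using assms(2) by (rule all_intro)
  show ?thesis
  proof (rule provesI)
    fix v assume v: "model v"
    show "v (Imp g (Imp (Ex x p) (Ex x q)))"
      using model_proves[OF v *] model_all_mp[OF v] v by (auto simp: model_Ex)
  qed
qed

lemma ex_cong:
  assumes "proves (Imp g (Bi p q))" and "x \<notin> fvars g"
  shows "proves (Imp g (Bi (Ex x p) (Ex x q)))"
proof -
  have "proves (Imp g (Imp p q))" "proves (Imp g (Imp q p))"
    using model_proves[OF _ assms(1)] by (intro provesI; auto)+
  from this[THEN ex_mono, OF assms(2)] show ?thesis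
    using model_proves by (intro provesI) fastforce
qed

text \<open>The eigenvariable rule, obtained by contraposition from the introduction of
  \<open>All\<close>. Together with \<open>rex_elim\<close> it is how the existence axioms are put
  to use.\<close>

lemma ex_elim:
  assumes "proves (Imp p q)" and "x \<notin> fvars q"
  shows "proves (Imp (Ex x p) q)"
proof -
  have "proves (Imp (Neg q) (Neg p))"
    using model_proves[OF _ assms(1)] by (intro provesI) auto
  then have "proves (Imp (Neg q) (All x (Neg p)))"
    using assms(2) by (intro all_intro) auto
  then show ?thesis
    using model_proves by (intro provesI) (fastforce simp: model_Ex)
qed

lemma rex_elim:
  assumes "proves (Imp (El (Var x) a) (Imp p q))" and "x \<notin> fvars q"
  shows "proves (Imp (Rex x a p) q)"
proof -
  have "proves (Imp (And (El (Var x) a) p) q)"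
    using model_proves[OF _ assms(1)] by (intro provesI) auto
  then have *: "proves (Imp (Ex x (And (El (Var x) a) p)) q)"
    using assms(2) by (rule ex_elim)
  show ?thesis
    using model_proves[OF _ *] model_proves[OF _ df_rex[of x a p]] by (intro provesI) auto
qed

section \<open>Congruence of equality\<close>

lemma fresh_var:
  assumes "finite S"
  obtains x :: nat where "x \<notin> S"
  using ex_new_if_finite[OF infinite_UNIV_nat assms] by blast

text \<open>Through \<open>df_cleq\<close>, equality of classes is equivalence of membership under a
  quantifier, so its laws are those of \<open>Bi\<close> carried through \<open>All\<close>.\<close>

lemma eq_refl: "proves (Eq a a)"
proof -
  obtain x where x: "x \<notin> tvars a" using fresh_var finite_vars by metis
  have "proves (Bi p p)" for p by (rule provesI) simp
  then have *: "proves (All x (Bi (El (Var x) a) (El (Var x) a)))" by (rule proves_gen)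
  show ?thesis
    using model_proves[OF _ df_cleq[OF x x]] model_proves[OF _ *] by (intro provesI) auto
qed

lemma eq_sym: "proves (Imp (Eq a b) (Eq b a))"
proof (rule provesI)
  fix v assume v: "model v"
  obtain x where x: "x \<notin> tvars a \<union> tvars b" using fresh_var finite_vars finite_UnI by metis
  have "proves (Imp (Bi p q) (Bi q p))" for p q by (rule provesI) auto
  from model_all_mono[OF v this] show "v (Imp (Eq a b) (Eq b a))"
    using model_proves[OF v df_cleq[of x a b]] model_proves[OF v df_cleq[of x b a]] x v by auto
qed

lemma eq_trans: "proves (Imp (Eq a b) (Imp (Eq b c) (Eq a c)))"
proof (rule provesI)
  fix v assume v: "model v"
  obtain x where x: "x \<notin> tvars a \<union> tvars b \<union> tvars c"
    using fresh_var finite_vars finite_UnI by metis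
  have "proves (Imp (Bi p q) (Imp (Bi q r) (Bi p r)))" for p q r by (rule provesI) auto
  from model_all_mp[OF v model_all_mono[OF v this]] show "v (Imp (Eq a b) (Imp (Eq b c) (Eq a c)))"
    using model_proves[OF v df_cleq[of x a b]] model_proves[OF v df_cleq[of x b c]]
      model_proves[OF v df_cleq[of x a c]] x v by auto
qed

lemma model_eq_refl [simp]: "model v \<Longrightarrow> v (Eq a a)"
  using eq_refl model_proves by blast

lemma model_eq_sym: "model v \<Longrightarrow> v (Eq a b) \<longleftrightarrow> v (Eq b a)"
  using model_proves[OF _ eq_sym] by (metis model_simps(1))

lemma model_eq_trans: "model v \<Longrightarrow> v (Eq a b) \<Longrightarrow> v (Eq b c) \<Longrightarrow> v (Eq a c)"
  using model_proves[OF _ eq_trans] by (metis model_simps(1))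

lemma model_eq_cong:
  "model v \<Longrightarrow> v (Eq a b) \<Longrightarrow> v (Eq c d) \<Longrightarrow> v (Eq a c) \<longleftrightarrow> v (Eq b d)"
  using model_eq_sym model_eq_trans by metis

section \<open>Congruence of membership and of the class constructors\<close>

lemma el_cong_left: "proves (Imp (Eq a b) (Bi (El a c) (El b c)))"
proof -
  obtain x where x: "x \<notin> tvars a \<union> tvars b \<union> tvars c"
    using fresh_var finite_vars finite_UnI by metis
  have "proves (Imp (Eq a b) (Bi (And (Eq (Var x) a) p) (And (Eq (Var x) b) p)))" for p
    by (rule provesI, simp) (metis model_eq_sym model_eq_trans)
  then have *: "proves (Imp (Eq a b) (Bi (Ex x (And (Eq (Var x) a) (El (Var x) c)))
      (Ex x (And (Eq (Var x) b) (El (Var x) c)))))"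
    using x by (intro ex_cong) auto
  show ?thesis
    using model_proves[OF _ *] model_proves[OF _ df_clel[of x a c]] model_proves[OF _ df_clel[of x b c]] x
    by (intro provesI) auto
qed

lemma el_mono_right: "proves (Imp (Eq c d) (Imp (El a c) (El a d)))"
proof (rule provesI)
  fix v assume v: "model v"
  obtain x where x: "x \<notin> tvars a \<union> tvars c \<union> tvars d"
    using fresh_var finite_vars finite_UnI by metis
  \<comment> \<open>The existential in \<open>df_clel\<close> is handled as a negated universal,
    hence the contraposed form.\<close>
  have "proves (Imp (Bi p q) (Imp (Neg (And r q)) (Neg (And r p))))" for p q r by (rule provesI) auto
  from model_all_mp[OF v model_all_mono[OF v this]] show "v (Imp (Eq c d) (Imp (El a c) (El a d)))"
    using model_proves[OF v df_cleq[of x c d]] model_proves[OF v df_clel[of x a c]]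
      model_proves[OF v df_clel[of x a d]] x v by (auto simp: model_Ex)
qed

lemma model_el_cong:
  assumes v: "model v" and "v (Eq a b)" and "v (Eq c d)"
  shows "v (El a c) \<longleftrightarrow> v (El b d)"
  using model_proves[OF v el_cong_left[of a b c]] model_proves[OF v el_mono_right[of c d b]]
    model_proves[OF v el_mono_right[of d c b]] assms model_eq_sym by auto

text \<open>Membership in an abstraction is \<open>Sb\<close>, whose definition has one conjunct
  outside any quantifier, where the hypothesis applies directly, and one under \<open>Ex\<close>,
  where \<open>ex_cong\<close> applies. The premise \<open>g\<close> is meant for equations between
  subterms; congruence of a constructor is then read off from its defining abstraction.\<close>

lemma abs_cong:
  assumes "proves (Imp g (Bi p q))" and "x \<notin> fvars g"
  shows "proves (Imp g (Eq (Abs x p) (Abs x q)))"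
proof -
  obtain y where y: "y \<notin> insert x (fvars g \<union> fvars p \<union> fvars q)"
    using fresh_var finite_vars finite_UnI finite_insert by metis
  have "proves (Imp g (Bi (And r p) (And r q)))" for r
    using model_proves[OF _ assms(1)] by (intro provesI) auto
  note ex = ex_cong[OF this assms(2)]
  have "proves (Imp g (Bi (El (Var y) (Abs x p)) (El (Var y) (Abs x q))))"
  proof (rule provesI)
    fix v assume v: "model v"
    show "v (Imp g (Bi (El (Var y) (Abs x p)) (El (Var y) (Abs x q))))"
      using v model_proves[OF v assms(1)] model_proves[OF v ex[of "Eq (Var x) (Var y)"]]
        model_proves[OF v df_clab] model_proves[OF v df_sb] by auto
  qed
  then have *: "proves (Imp g (All y (Bi (El (Var y) (Abs x p)) (El (Var y) (Abs x q)))))"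
    using y by (intro all_intro) auto
  show ?thesis
    using model_proves[OF _ *] model_proves[OF _ df_cleq[of y "Abs x p" "Abs x q"]] y
    by (intro provesI) auto
qed

lemma union_cong:
  assumes v: "model v" and "v (Eq a b)" and "v (Eq c d)"
  shows "v (Eq (Union a c) (Union b d))"
proof -
  \<comment> \<open>One variable fresh for both sides lets the two definitions be unfolded with the
    same bound variable, so no renaming of bound variables has to be proved. The later congruences
    do the same.\<close>
  obtain x where x: "x \<notin> tvars a \<union> tvars b \<union> tvars c \<union> tvars d"
    using fresh_var finite_vars finite_UnI by metis
  have "proves (Imp (And (Eq a b) (Eq c d))
      (Bi (Or (El (Var x) a) (El (Var x) c)) (Or (El (Var x) b) (El (Var x) d))))"
    by (rule provesI, simp) (metis model_el_cong model_eq_refl)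
  from abs_cong[OF this, of x, THEN model_proves[OF v]] show ?thesis
    using assms x model_eq_cong[OF v df_un[THEN model_proves[OF v]] df_un[THEN model_proves[OF v]]]
    by auto
qed

lemma sing_cong:
  assumes v: "model v" and "v (Eq a b)"
  shows "v (Eq (Sing a) (Sing b))"
proof -
  obtain x where x: "x \<notin> tvars a \<union> tvars b"
    using fresh_var finite_vars finite_UnI by metis
  have "proves (Imp (Eq a b) (Bi (Eq (Var x) a) (Eq (Var x) b)))"
    by (rule provesI, simp) (metis model_eq_cong model_eq_refl)
  from abs_cong[OF this, of x, THEN model_proves[OF v]] show ?thesis
    using assms x model_eq_cong[OF v df_sn[THEN model_proves[OF v]] df_sn[THEN model_proves[OF v]]]
    by auto
qed

lemma pair_cong:
  assumes v: "model v" and "v (Eq a b)" and "v (Eq c d)"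
  shows "v (Eq (Pair a c) (Pair b d))"
  using assms union_cong sing_cong model_eq_cong[OF v df_pr[THEN model_proves[OF v]] df_pr[THEN model_proves[OF v]]]
  by blast

lemma opair_cong:
  assumes v: "model v" and "v (Eq a b)" and "v (Eq c d)"
  shows "v (Eq (OPair a c) (OPair b d))"
proof -
  obtain x where x: "x \<notin> tvars a \<union> tvars b \<union> tvars c \<union> tvars d"
    using fresh_var finite_vars finite_UnI by metis
  have "proves (Imp (And (Eq a b) (Eq c d)) (Bi
      (And3 (El a (Cst KUniv)) (El c (Cst KUniv)) (El (Var x) (Pair (Sing a) (Pair a c))))
      (And3 (El b (Cst KUniv)) (El d (Cst KUniv)) (El (Var x) (Pair (Sing b) (Pair b d))))))"
  proof (rule provesI)
    fix w assume w: "model w"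
    have "w (Eq (Pair (Sing a) (Pair a c)) (Pair (Sing b) (Pair b d)))" if "w (Eq a b)" "w (Eq c d)"
      using w that by (simp add: pair_cong sing_cong)
    then show "w (Imp (And (Eq a b) (Eq c d)) (Bi
      (And3 (El a (Cst KUniv)) (El c (Cst KUniv)) (El (Var x) (Pair (Sing a) (Pair a c))))
      (And3 (El b (Cst KUniv)) (El d (Cst KUniv)) (El (Var x) (Pair (Sing b) (Pair b d))))))"
      using w model_el_cong[OF w] model_eq_refl[OF w] by (simp (no_asm_simp)) metis
  qed
  from abs_cong[OF this, of x, THEN model_proves[OF v]] show ?thesis
    using assms x model_eq_cong[OF v df_op[THEN model_proves[OF v]] df_op[THEN model_proves[OF v]]]
    by auto
qed

lemma bigU_cong:
  assumes v: "model v" and "v (Eq a b)"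
  shows "v (Eq (BigU a) (BigU b))"
proof -
  obtain x where x: "x \<notin> tvars a \<union> tvars b"
    using fresh_var finite_vars finite_UnI by metis
  obtain y where y: "y \<notin> insert x (tvars a \<union> tvars b)"
    using fresh_var finite_vars finite_UnI finite_insert by metis
  have "proves (Imp (Eq a b) (Bi (And (El (Var x) (Var y)) (El (Var y) a))
      (And (El (Var x) (Var y)) (El (Var y) b))))"
    by (rule provesI, simp) (metis model_el_cong model_eq_refl)
  from abs_cong[OF ex_cong[OF this, of y], of x, THEN model_proves[OF v]] show ?thesis
    using assms x y
      model_eq_cong[OF v df_uni[THEN model_proves[OF v]] df_uni[THEN model_proves[OF v]], of x y a x y b]
    by auto
qed

lemma rel_cong:
  assumes v: "model v" and "v (Eq a b)" and "v (Eq r s)" and "v (Eq c d)"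
  shows "v (Rel a r c) \<longleftrightarrow> v (Rel b s d)"
  using model_proves[OF v df_br] model_el_cong[OF v] opair_cong[OF v] assms by simp

lemma iota_cong:
  assumes "proves (Imp g (Bi p q))" and "x \<notin> fvars g"
  shows "proves (Imp g (Eq (Iota x p) (Iota x q)))"
proof -
  obtain y where y: "y \<notin> insert x (fvars g \<union> fvars p \<union> fvars q)"
    using fresh_var finite_vars finite_UnI finite_insert by metis
  have "proves (Imp g (Bi (Eq (Abs x p) (Sing (Var y))) (Eq (Abs x q) (Sing (Var y)))))"
    by (rule provesI, simp)
      (metis model_eq_cong model_eq_refl model_proves[OF _ abs_cong[OF assms]] model_simps(1))
  then have *: "proves (Imp g (Eq (Abs y (Eq (Abs x p) (Sing (Var y)))) (Abs y (Eq (Abs x q) (Sing (Var y))))))"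
    using y by (intro abs_cong) auto
  show ?thesis
  proof (rule provesI)
    fix v assume v: "model v"
    show "v (Imp g (Eq (Iota x p) (Iota x q)))"
      using v y model_proves[OF v *] bigU_cong[OF v]
        model_eq_cong[OF v df_iota[THEN model_proves[OF v]] df_iota[THEN model_proves[OF v]], of x y p x y q]
      by auto
  qed
qed

lemma app_cong:
  assumes v: "model v" and "v (Eq f g)" and "v (Eq a b)"
  shows "v (Eq (App f a) (App g b))"
proof -
  obtain x where x: "x \<notin> tvars f \<union> tvars g \<union> tvars a \<union> tvars b"
    using fresh_var finite_vars finite_UnI by metis
  have "proves (Imp (And (Eq f g) (Eq a b)) (Bi (Rel a f (Var x)) (Rel b g (Var x))))"
  proof (rule provesI)
    fix w assume w: "model w"
    show "w (Imp (And (Eq f g) (Eq a b)) (Bi (Rel a f (Var x)) (Rel b g (Var x))))"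
      using w rel_cong[OF w, of a b f g "Var x" "Var x"] by simp
  qed
  from iota_cong[OF this, of x, THEN model_proves[OF v]] show ?thesis
    using assms x
      model_eq_cong[OF v df_fv[THEN model_proves[OF v]] df_fv[THEN model_proves[OF v]], of x a f x b g]
    by auto
qed

lemma opv_cong:
  assumes v: "model v" and "v (Eq a b)" and "v (Eq f g)" and "v (Eq c d)"
  shows "v (Eq (Opv a f c) (Opv b g d))"
  using app_cong[OF v assms(3) opair_cong[OF v assms(2,4)]]
    model_eq_cong[OF v df_ov[THEN model_proves[OF v]] df_ov[THEN model_proves[OF v]]]
  by simp

end

section \<open>Arithmetic from the axioms for real and complex numbers\<close>

text \<open>
  The existence axioms are left out, because the algebra of terms in a model need not contain
  witnesses for them. A lemma whose name ends in \<open>_if\<close> takes the witnesses as hypotheses and is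
  applied to eigenvariables later. There is no axiom for commutativity of addition or for the
  neutrality of \<open>0\<close>.
\<close>

locale precomplex =
  fixes add :: "'a \<Rightarrow> 'a \<Rightarrow> 'a" (infixl "\<oplus>" 65)
    and mul :: "'a \<Rightarrow> 'a \<Rightarrow> 'a" and zero one im :: 'a
    and cn re :: "'a set" and less :: "'a \<Rightarrow> 'a \<Rightarrow> bool"
  assumes re_cn: "a \<in> re \<Longrightarrow> a \<in> cn"
    and one_cn: "one \<in> cn" and im_cn: "im \<in> cn"
    and add_cn: "a \<in> cn \<Longrightarrow> b \<in> cn \<Longrightarrow> a \<oplus> b \<in> cn"
    and add_re: "a \<in> re \<Longrightarrow> b \<in> re \<Longrightarrow> a \<oplus> b \<in> re"
    and mul_cn: "a \<in> cn \<Longrightarrow> b \<in> cn \<Longrightarrow> mul a b \<in> cn"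
    and mul_re: "a \<in> re \<Longrightarrow> b \<in> re \<Longrightarrow> mul a b \<in> re"
    and mul_comm: "a \<in> cn \<Longrightarrow> b \<in> cn \<Longrightarrow> mul a b = mul b a"
    and add_assoc: "a \<in> cn \<Longrightarrow> b \<in> cn \<Longrightarrow> c \<in> cn \<Longrightarrow> (a \<oplus> b) \<oplus> c = a \<oplus> (b \<oplus> c)"
    and distrib: "a \<in> cn \<Longrightarrow> b \<in> cn \<Longrightarrow> c \<in> cn \<Longrightarrow> mul a (b \<oplus> c) = mul a b \<oplus> mul a c"
    and im_square: "mul im im \<oplus> one = zero"
    and one_ne_zero: "one \<noteq> zero"
    and mul_one: "a \<in> re \<Longrightarrow> mul a one = a"
    and trichotomy: "a \<in> re \<Longrightarrow> b \<in> re \<Longrightarrow> less a b \<longleftrightarrow> \<not> (a = b \<or> less b a)"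
    and less_add: "a \<in> re \<Longrightarrow> b \<in> re \<Longrightarrow> c \<in> re \<Longrightarrow> less a b \<Longrightarrow> less (c \<oplus> a) (c \<oplus> b)"
begin

text \<open>If \<open>a\<close> and \<open>b\<close> differed, one would be less than the other;
  adding \<open>c\<close> on the left preserves this, but trichotomy makes \<open>less\<close>
  irreflexive.\<close>

lemma add_left_cancel:
  assumes "a \<in> re" "b \<in> re" "c \<in> re" "c \<oplus> a = c \<oplus> b"
  shows "a = b"
  using assms trichotomy less_add add_re by metis

lemma zero_cn: "zero \<in> cn"
  using im_square add_cn mul_cn im_cn one_cn by metis

end

text \<open>Each extension assumes laws that are proved as theorems of the formal system, with the
  help of the preceding stage and of eigenvariables, before the extension is shown to hold in
  models.\<close>

locale precomplex_re = precomplex +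
  assumes one_re: "one \<in> re" and zero_re: "zero \<in> re"
begin

text \<open>Here \<open>c\<close> is a right negative of \<open>zero\<close>, and \<open>d\<close> a
  reciprocal of it. Distributing \<open>d\<close> over \<open>zero \<oplus> c\<close> gives
  \<open>r = r \<oplus> one\<close> for \<open>r = mul zero d\<close>, hence
  \<open>one = one \<oplus> one\<close> by cancellation. This is not yet contradictory;
  multiplication by \<open>zero\<close> turns it into the claim.\<close>

lemma zero_add_zero_if:
  assumes c: "c \<in> re" "zero \<oplus> c = zero" and d: "d \<in> re" "mul c d = one"
  shows "zero \<oplus> zero = zero"
proof -
  let ?r = "mul zero d"
  have r: "?r \<in> re" using d zero_re mul_re by blast
  have "?r = mul d (zero \<oplus> c)"
    using c d mul_comm re_cn zero_cn by simp
  also have "\<dots> = ?r \<oplus> one"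
    using c d mul_comm[of d c] mul_comm[of d zero] distrib[of d zero c] re_cn zero_cn by simp
  finally have "?r \<oplus> one = ?r \<oplus> (one \<oplus> one)"
    using r re_cn one_cn add_assoc by metis
  then have "one = one \<oplus> one"
    using add_left_cancel r one_re add_re by blast
  then have "mul zero one = mul zero one \<oplus> mul zero one"
    using distrib one_cn zero_cn by metis
  then show ?thesis using mul_one zero_re by simp
qed

end

locale precomplex_zero = precomplex_re +
  assumes zero_add_zero: "zero \<oplus> zero = zero"
begin

text \<open>Cancel \<open>zero\<close> on the left of
  \<open>zero \<oplus> (zero \<oplus> a) = zero \<oplus> a\<close>.\<close>

lemma zero_add: "a \<in> re \<Longrightarrow> zero \<oplus> a = a"
  using add_left_cancel[of "zero \<oplus> a" a zero] add_assoc[of zero zero a]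
  by (simp add: zero_add_zero zero_re re_cn add_re)

text \<open>
  The order axioms do not exclude \<open>1 + 1 = 1\<close>; the equation \<open>i * i + 1 = 0\<close> does.
\<close>

lemma one_add_one: "one \<oplus> one \<noteq> one"
proof
  assume "one \<oplus> one = one"
  then have "(mul im im \<oplus> one) \<oplus> one = mul im im \<oplus> one"
    using add_assoc mul_cn im_cn one_cn by metis
  then have "zero \<oplus> one = zero" by (simp only: im_square)
  then show False using zero_add one_re one_ne_zero by simp
qed

text \<open>The product \<open>mul a zero\<close> is additively idempotent. A reciprocal
  \<open>f\<close> of it would carry idempotence over to \<open>one\<close>; so the product has no
  reciprocal and must be \<open>zero\<close>.\<close>

lemma mul_zero_if:
  assumes a: "a \<in> re" and f: "f \<in> re" "mul (mul a zero) f = one"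
  shows False
proof -
  have e: "mul a zero \<oplus> mul a zero = mul a zero"
    using distrib[of a zero zero] a by (simp add: re_cn zero_cn zero_add_zero)
  have "mul f (mul a zero) = one"
    using f a mul_comm re_cn mul_cn zero_cn by metis
  with e have "one \<oplus> one = one"
    using distrib f a re_cn mul_cn zero_cn by metis
  then show False using one_add_one by blast
qed

text \<open>The square of \<open>im\<close> is a left negative of \<open>one\<close>, and
  \<open>s\<close> a right one. As in a group, \<open>s\<close> is then also a left negative, and
  \<open>one \<oplus> zero = one \<oplus> (s \<oplus> one) = (one \<oplus> s) \<oplus> one = zero
  \<oplus> one\<close>.\<close>

lemma one_add_zero_if:
  assumes s: "s \<in> re" "one \<oplus> s = zero"
  shows "one \<oplus> zero = one"
proof -
  let ?j = "mul im im"
  have j: "?j \<in> cn" using mul_cn im_cn by blast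
  have "s = (?j \<oplus> one) \<oplus> s" using zero_add s im_square by simp
  also have "\<dots> = ?j \<oplus> zero" using add_assoc j one_cn s re_cn by metis
  finally have "s \<oplus> one = ?j \<oplus> (zero \<oplus> one)"
    using add_assoc j zero_cn one_cn by metis
  then have "s \<oplus> one = zero" using zero_add one_re im_square by simp
  then have "one \<oplus> zero = (one \<oplus> s) \<oplus> one" using add_assoc one_cn s re_cn by metis
  then show ?thesis using s zero_add one_re by simp
qed

end

locale precomplex_arith = precomplex_zero +
  assumes mul_zero: "a \<in> re \<Longrightarrow> mul a zero = zero" and one_add_zero: "one \<oplus> zero = one"
begin

primrec nat_in :: "nat \<Rightarrow> 'a" where
  "nat_in 0 = zero"
| "nat_in (Suc n) = nat_in n \<oplus> one"

lemma nat_in_re: "nat_in n \<in> re"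
  by (induction n) (simp_all add: zero_re one_re add_re)

lemma nat_in_one: "nat_in (Suc 0) = one"
  by (simp add: zero_add one_re)

lemma nat_in_add: "nat_in (m + n) = nat_in m \<oplus> nat_in n"
proof (induction n)
  \<comment> \<open>Right neutrality of \<open>zero\<close> is known only for \<open>zero\<close>
    and \<open>one\<close>; for a successor it follows by associativity from its last
    summand.\<close>
  case 0
  show ?case
  proof (cases m)
    case (Suc k)
    then show ?thesis
      using add_assoc[of "nat_in k" one zero]
      by (simp add: nat_in_re re_cn one_cn zero_cn one_add_zero)
  qed (simp add: zero_add_zero)
next
  case (Suc n)
  then show ?case using add_assoc nat_in_re re_cn one_cn by simp
qed

text \<open>The induction is on the second factor because \<open>distrib\<close>,
  \<open>mul_one\<close> and \<open>mul_zero\<close> all concern the right factor.\<close>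

lemma nat_in_mul: "nat_in (m * n) = mul (nat_in m) (nat_in n)"
proof (induction n)
  case (Suc n)
  have "mul (nat_in m) (nat_in (Suc n)) = nat_in (m * n + m)"
    using Suc distrib nat_in_re re_cn one_cn mul_one by (simp add: nat_in_add)
  then show ?case by (simp only: mult_Suc_right add.commute)
qed (simp add: mul_zero nat_in_re)

end

section \<open>Transfer between the algebra and the theorems of the formal system\<close>

context embedding begin

text \<open>
  In the following proof the inclusion \<open>RR C_ CC\<close> is unfolded without any instantiation of a bound
  variable: membership in a class abstraction is substitution, which yields a witness equal to \<open>x\<close>.
\<close>

lemma re_cn: "proves (Imp (El a (Cst KRR)) (El a (Cst KCC)))"
proof -
  obtain x where x: "x \<notin> tvars a"
    using fresh_var finite_vars by metis
  define y where "y = Suc x"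
  let ?R = "El (Var y) (Cst KRR)" and ?C = "El (Var y) (Cst KCC)"
  have "proves (Imp (And (Eq (Var y) (Var x)) (And ?R ?C)) (El (Var x) (Cst KCC)))"
    by (rule provesI, simp) (metis model_el_cong model_eq_refl)
  then have ex: "proves (Imp (Ex y (And (Eq (Var y) (Var x)) (And ?R ?C))) (El (Var x) (Cst KCC)))"
    by (rule ex_elim) (simp add: y_def)
  \<comment> \<open>By \<open>df_clel\<close>, a class belongs to \<open>RR\<close> when some set
    variable equal to it does, so the inclusion for variables extends to arbitrary classes.\<close>
  have "proves (Imp (And (Eq (Var x) a) (El (Var x) (Cst KRR))) (El a (Cst KCC)))"
  proof (rule provesI)
    fix v assume v: "model v"
    have "v (Eq (Inter (Cst KRR) (Cst KCC)) (Abs y (And ?R ?C)))"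
      "v (Eq (Inter (Cst KRR) (Cst KCC)) (Cst KRR))"
      using model_proves[OF v df_ss[of "Cst KRR" "Cst KCC"]] model_proves[OF v re_sub_cn]
        model_proves[OF v df_in[of y]] v by auto
    then have "v (Eq (Cst KRR) (Abs y (And ?R ?C)))"
      using model_eq_sym[OF v] model_eq_trans[OF v] by blast
    then have "v (El (Var x) (Cst KRR)) \<longleftrightarrow> v (El (Var x) (Abs y (And ?R ?C)))"
      by (rule model_el_cong[OF v model_eq_refl[OF v]])
    moreover have "v (El (Var x) (Abs y (And ?R ?C))) \<Longrightarrow> v (El (Var x) (Cst KCC))"
      using model_proves[OF v ex] model_proves[OF v df_clab[of x y]] model_proves[OF v df_sb[of x y]] v
      by simp
    ultimately show "v (Imp (And (Eq (Var x) a) (El (Var x) (Cst KRR))) (El a (Cst KCC)))"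
      using v model_el_cong[OF v _ model_eq_refl[OF v], of "Var x" a] by auto
  qed
  then have *: "proves (Imp (Ex x (And (Eq (Var x) a) (El (Var x) (Cst KRR)))) (El a (Cst KCC)))"
    using x by (intro ex_elim) auto
  show ?thesis
    using model_proves[OF _ df_clel[of x a "Cst KRR"]] model_proves[OF _ *] x by (intro provesI) auto
qed

definition cl :: "(fm \<Rightarrow> bool) \<Rightarrow> trm \<Rightarrow> trm set" where
  "cl v a = {b. v (Eq a b)}"

definition set_cl :: "(fm \<Rightarrow> bool) \<Rightarrow> trm \<Rightarrow> trm set set" where
  "set_cl v r = cl v ` {a. v (El a r)}"

text \<open>The operation on the quotient is taken on chosen representatives;
  \<open>opv_cong\<close> makes the choice immaterial.\<close>

definition op_cl :: "(fm \<Rightarrow> bool) \<Rightarrow> trm \<Rightarrow> trm set \<Rightarrow> trm set \<Rightarrow> trm set" where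
  "op_cl v f s t = cl v (Opv (SOME a. cl v a = s) f (SOME b. cl v b = t))"

definition rel_cl :: "(fm \<Rightarrow> bool) \<Rightarrow> trm \<Rightarrow> trm set \<Rightarrow> trm set \<Rightarrow> bool" where
  "rel_cl v r s t \<longleftrightarrow> v (Rel (SOME a. cl v a = s) r (SOME b. cl v b = t))"

context
  fixes v
  assumes v: "model v"
begin

lemma cl_eq_iff: "cl v a = cl v b \<longleftrightarrow> v (Eq a b)"
proof
  assume "cl v a = cl v b"
  then have "b \<in> cl v a" using model_eq_refl[OF v] by (simp add: cl_def)
  then show "v (Eq a b)" by (simp add: cl_def)
next
  assume "v (Eq a b)"
  then have "v (Eq a c) \<longleftrightarrow> v (Eq b c)" for c
    using model_eq_cong[OF v _ model_eq_refl[OF v]] by blast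
  then show "cl v a = cl v b" by (simp add: cl_def)
qed

lemma some_cl: "v (Eq (SOME b. cl v b = cl v a) a)"
  using someI[of "\<lambda>b. cl v b = cl v a" a] cl_eq_iff by simp

lemma cl_in_set_cl: "cl v a \<in> set_cl v r \<longleftrightarrow> v (El a r)"
  using model_el_cong[OF v _ model_eq_refl[OF v]] cl_eq_iff unfolding set_cl_def by blast

lemma op_cl: "op_cl v f (cl v a) (cl v b) = cl v (Opv a f b)"
  using opv_cong[OF v some_cl model_eq_refl[OF v] some_cl] by (simp add: op_cl_def cl_eq_iff)

lemma rel_cl: "rel_cl v r (cl v a) (cl v b) \<longleftrightarrow> v (Rel a r b)"
  using rel_cong[OF v some_cl model_eq_refl[OF v] some_cl] by (simp add: rel_cl_def)

lemma set_clE: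
  assumes "s \<in> set_cl v r"
  obtains a where "s = cl v a" "v (El a r)"
  using assms by (auto simp: set_cl_def)

end

lemmas cl_simps = cl_eq_iff cl_in_set_cl op_cl rel_cl

abbreviation "in_model v L \<equiv> L (op_cl v (Cst KPlus)) (op_cl v (Cst KTimes)) (cl v (Cst KZero))
  (cl v (Cst KOne)) (cl v (Cst KI)) (set_cl v (Cst KCC)) (set_cl v (Cst KRR)) (rel_cl v (Cst KLess))"

lemma precomplex_model:
  assumes v: "model v"
  shows "in_model v precomplex"
proof -
  note axioms = re_cn one_cn i_cn add_cn add_re mul_cn mul_re mul_comm add_assoc distrib i_square
    one_ne_zero mul_one less_add
  note model_axioms = axioms[THEN model_proves[OF v], simplified model_simps[OF v]]
  show ?thesis
  proof (rule precomplex.intro)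
    fix s t assume "s \<in> set_cl v (Cst KRR)" "t \<in> set_cl v (Cst KRR)"
    then obtain a b where ab: "s = cl v a" "v (El a (Cst KRR))" "t = cl v b" "v (El b (Cst KRR))"
      using set_clE[OF v] by metis
    then show "rel_cl v (Cst KLess) s t \<longleftrightarrow> \<not> (s = t \<or> rel_cl v (Cst KLess) t s)"
      using model_proves[OF v less_trichotomy[of a b]] v by (simp add: cl_simps[OF v])
  qed ((elim set_clE[OF v])?, simp add: cl_simps[OF v] model_axioms)+
qed

text \<open>The reciprocal axiom exhibits \<open>1\<close> as a product of two reals.\<close>

lemma one_re_if: "proves (Imp (And (El a (Cst KRR)) (Ne a (Cst KZero))) (El (Cst KOne) (Cst KRR)))"
proof -
  obtain x where x: "x \<notin> tvars a"
    using fresh_var finite_vars by metis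
  have "proves (Imp (El (Var x) (Cst KRR)) (Imp (Eq (Opv a (Cst KTimes) (Var x)) (Cst KOne))
      (Imp (El a (Cst KRR)) (El (Cst KOne) (Cst KRR)))))"
  proof (rule provesI)
    fix v assume v: "model v"
    show "v (Imp (El (Var x) (Cst KRR)) (Imp (Eq (Opv a (Cst KTimes) (Var x)) (Cst KOne))
        (Imp (El a (Cst KRR)) (El (Cst KOne) (Cst KRR)))))"
      using v model_proves[OF v mul_re[of a "Var x"]]
        model_el_cong[OF v _ model_eq_refl[OF v], of "Opv a (Cst KTimes) (Var x)" "Cst KOne"] by auto
  qed
  then have *: "proves (Imp (Rex x (Cst KRR) (Eq (Opv a (Cst KTimes) (Var x)) (Cst KOne)))
      (Imp (El a (Cst KRR)) (El (Cst KOne) (Cst KRR))))"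
    using x by (intro rex_elim) auto
  show ?thesis
    using model_proves[OF _ *] model_proves[OF _ ex_recip[OF x]] by (intro provesI) auto
qed

lemma zero_cn: "proves (El (Cst KZero) (Cst KCC))"
  using precomplex.zero_cn[OF precomplex_model] cl_in_set_cl by (intro provesI) blast

text \<open>
  Since \<open>1\<close> and \<open>0\<close> differ, a real or imaginary part of one of them is nonzero.
\<close>

lemma one_re: "proves (El (Cst KOne) (Cst KRR))"
proof -
  let ?sum = "\<lambda>x y. Opv (Var x) (Cst KPlus) (Opv (Cst KI) (Cst KTimes) (Var y))"
  let ?re = "\<lambda>x. El (Var x) (Cst KRR)" and ?goal = "El (Cst KOne) (Cst KRR)"
  have "proves (Imp (?re 3) (Imp (Eq (Cst KZero) (?sum 2 3))
      (Imp (?re 2) (Imp (?re 0) (Imp (?re 1) (Imp (Eq (Cst KOne) (?sum 0 1)) ?goal))))))"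
  proof (rule provesI)
    fix v assume v: "model v"
    have "v (Eq (?sum 0 1) (?sum 2 3))" if zeros: "\<And>x. x \<in> {0, 1, 2, 3} \<Longrightarrow> v (Eq (Var x) (Cst KZero))"
    proof -
      have eq: "v (Eq (Var x) (Var y))" if "x \<in> {0, 1, 2, 3}" "y \<in> {0, 1, 2, 3}" for x y
        using model_eq_trans[OF v zeros[OF that(1)]] zeros[OF that(2)] model_eq_sym[OF v, of "Var y"]
        by simp
      show ?thesis
        by (intro opv_cong[OF v] model_eq_refl[OF v] eq) simp_all
    qed
    moreover have "\<not> v (Eq (Cst KOne) (Cst KZero))"
      using model_proves[OF v one_ne_zero] v by simp
    ultimately show "v (Imp (?re 3) (Imp (Eq (Cst KZero) (?sum 2 3))
      (Imp (?re 2) (Imp (?re 0) (Imp (?re 1) (Imp (Eq (Cst KOne) (?sum 0 1)) ?goal))))))"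
      using v model_proves[OF v one_re_if] model_eq_cong[OF v, of "Cst KOne" "?sum 0 1" "Cst KZero" "?sum 2 3"]
      by auto
  qed
  then have "proves (Imp (Rex 3 (Cst KRR) (Eq (Cst KZero) (?sum 2 3)))
      (Imp (?re 2) (Imp (?re 0) (Imp (?re 1) (Imp (Eq (Cst KOne) (?sum 0 1)) ?goal)))))"
    by (rule rex_elim) simp
  \<comment> \<open>Premises are exchanged so that the membership of the next eigenvariable stands
    in front, as \<open>rex_elim\<close> requires.\<close>
  then have "proves (Imp (?re 2) (Imp (Rex 3 (Cst KRR) (Eq (Cst KZero) (?sum 2 3)))
      (Imp (?re 0) (Imp (?re 1) (Imp (Eq (Cst KOne) (?sum 0 1)) ?goal)))))"
    using model_proves by (intro provesI) fastforce
  then have *: "proves (Imp (Rex 2 (Cst KRR) (Rex 3 (Cst KRR) (Eq (Cst KZero) (?sum 2 3))))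
      (Imp (?re 0) (Imp (?re 1) (Imp (Eq (Cst KOne) (?sum 0 1)) ?goal))))"
    by (rule rex_elim) simp
  have "proves (Imp (?re 1) (Imp (Eq (Cst KOne) (?sum 0 1)) (Imp (?re 0) ?goal)))"
    using model_proves[OF _ *] model_proves[OF _ zero_cn]
      model_proves[OF _ cn_decomp[of 2 3 "Cst KZero"]] by (intro provesI) auto
  then have "proves (Imp (Rex 1 (Cst KRR) (Eq (Cst KOne) (?sum 0 1))) (Imp (?re 0) ?goal))"
    by (rule rex_elim) simp
  then have "proves (Imp (?re 0) (Imp (Rex 1 (Cst KRR) (Eq (Cst KOne) (?sum 0 1))) ?goal))"
    using model_proves by (intro provesI) fastforce
  then have **: "proves (Imp (Rex 0 (Cst KRR) (Rex 1 (Cst KRR) (Eq (Cst KOne) (?sum 0 1)))) ?goal)"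
    by (rule rex_elim) simp
  show ?thesis
    using model_proves[OF _ **] model_proves[OF _ one_cn]
      model_proves[OF _ cn_decomp[of 0 1 "Cst KOne"]] by (intro provesI) auto
qed

text \<open>The negative of \<open>1\<close> exhibits \<open>0\<close> as a sum of two
  reals.\<close>

lemma zero_re: "proves (El (Cst KZero) (Cst KRR))"
proof -
  let ?sum = "Opv (Cst KOne) (Cst KPlus) (Var 0)"
  have "proves (Imp (El (Var 0) (Cst KRR)) (Imp (Eq ?sum (Cst KZero)) (El (Cst KZero) (Cst KRR))))"
  proof (rule provesI)
    fix v assume v: "model v"
    show "v (Imp (El (Var 0) (Cst KRR)) (Imp (Eq ?sum (Cst KZero)) (El (Cst KZero) (Cst KRR))))"
      using v model_proves[OF v one_re] model_proves[OF v add_re[of "Cst KOne" "Var 0"]]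
        model_el_cong[OF v _ model_eq_refl[OF v], of ?sum "Cst KZero"] by auto
  qed
  then have *: "proves (Imp (Rex 0 (Cst KRR) (Eq ?sum (Cst KZero))) (El (Cst KZero) (Cst KRR)))"
    by (rule rex_elim) simp
  show ?thesis
    using model_proves[OF _ *] model_proves[OF _ ex_neg[of 0 "Cst KOne"]] model_proves[OF _ one_re]
    by (intro provesI) auto
qed

lemma precomplex_re_model:
  assumes v: "model v"
  shows "in_model v precomplex_re"
  using model_proves[OF v one_re] model_proves[OF v zero_re]
  by (intro precomplex_re.intro precomplex_model v precomplex_re_axioms.intro) (simp_all add: cl_simps[OF v])

lemma zero_add_zero: "proves (Eq (Opv (Cst KZero) (Cst KPlus) (Cst KZero)) (Cst KZero))"
  (is "proves ?goal")
proof -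
  let ?re = "\<lambda>x. El (Var x) (Cst KRR)"
  let ?c = "Eq (Opv (Cst KZero) (Cst KPlus) (Var 0)) (Cst KZero)"
  let ?d = "Eq (Opv (Var 0) (Cst KTimes) (Var 1)) (Cst KOne)"
  have "proves (Imp (?re 1) (Imp ?d (Imp (And (?re 0) ?c) ?goal)))"
  proof (rule provesI)
    fix v assume v: "model v"
    show "v (Imp (?re 1) (Imp ?d (Imp (And (?re 0) ?c) ?goal)))"
      using v precomplex_re.zero_add_zero_if[OF precomplex_re_model[OF v], of "cl v (Var 0)" "cl v (Var 1)"]
      by (simp add: cl_simps[OF v])
  qed
  then have *: "proves (Imp (Rex 1 (Cst KRR) ?d) (Imp (And (?re 0) ?c) ?goal))"
    by (rule rex_elim) simp
  have "proves (Imp (?re 0) (Imp ?c ?goal))"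
  proof (rule provesI)
    fix v assume v: "model v"
    \<comment> \<open>If the negative of \<open>0\<close> is \<open>0\<close> itself, its defining
      equation is the goal; otherwise it has a reciprocal and the algebraic lemma applies.\<close>
    have "v ?c \<longleftrightarrow> v ?goal" if "v (Eq (Var 0) (Cst KZero))"
      using opv_cong[OF v model_eq_refl[OF v] model_eq_refl[OF v] that] model_eq_cong[OF v]
        model_eq_refl[OF v] by blast
    then show "v (Imp (?re 0) (Imp ?c ?goal))"
      using v model_proves[OF v *] model_proves[OF v ex_recip[of 1 "Var 0"]] by auto
  qed
  then have **: "proves (Imp (Rex 0 (Cst KRR) ?c) ?goal)"
    by (rule rex_elim) simp
  show ?thesis
    using model_proves[OF _ **] model_proves[OF _ ex_neg[of 0 "Cst KZero"]] model_proves[OF _ zero_re]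
    by (intro provesI) auto
qed

lemma precomplex_zero_model:
  assumes v: "model v"
  shows "in_model v precomplex_zero"
  using model_proves[OF v zero_add_zero]
  by (intro precomplex_zero.intro precomplex_re_model v precomplex_zero_axioms.intro)
    (simp_all add: cl_simps[OF v])

lemma mul_zero: "proves (Imp (El a (Cst KRR)) (Eq (Opv a (Cst KTimes) (Cst KZero)) (Cst KZero)))"
proof -
  obtain x where x: "x \<notin> tvars a"
    using fresh_var finite_vars by metis
  let ?a = "Opv a (Cst KTimes) (Cst KZero)"
  let ?f = "Eq (Opv ?a (Cst KTimes) (Var x)) (Cst KOne)"
  let ?goal = "Eq ?a (Cst KZero)"
  have "proves (Imp (El (Var x) (Cst KRR)) (Imp ?f (Imp (El a (Cst KRR)) ?goal)))"
  proof (rule provesI)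
    fix v assume v: "model v"
    show "v (Imp (El (Var x) (Cst KRR)) (Imp ?f (Imp (El a (Cst KRR)) ?goal)))"
      using v precomplex_zero.mul_zero_if[OF precomplex_zero_model[OF v], of "cl v a" "cl v (Var x)"]
      by (auto simp: cl_simps[OF v])
  qed
  then have *: "proves (Imp (Rex x (Cst KRR) ?f) (Imp (El a (Cst KRR)) ?goal))"
    using x by (intro rex_elim) auto
  show ?thesis
    using model_proves[OF _ *] model_proves[OF _ ex_recip[of x ?a]] model_proves[OF _ zero_re]
      model_proves[OF _ mul_re[of a "Cst KZero"]] x by (intro provesI) auto
qed

lemma one_add_zero: "proves (Eq (Opv (Cst KOne) (Cst KPlus) (Cst KZero)) (Cst KOne))"
  (is "proves ?goal")
proof -
  let ?s = "Eq (Opv (Cst KOne) (Cst KPlus) (Var 0)) (Cst KZero)"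
  have "proves (Imp (El (Var 0) (Cst KRR)) (Imp ?s ?goal))"
  proof (rule provesI)
    fix v assume v: "model v"
    show "v (Imp (El (Var 0) (Cst KRR)) (Imp ?s ?goal))"
      using v precomplex_zero.one_add_zero_if[OF precomplex_zero_model[OF v], of "cl v (Var 0)"]
      by (simp add: cl_simps[OF v])
  qed
  then have *: "proves (Imp (Rex 0 (Cst KRR) ?s) ?goal)"
    by (rule rex_elim) simp
  show ?thesis
    using model_proves[OF _ *] model_proves[OF _ ex_neg[of 0 "Cst KOne"]] model_proves[OF _ one_re]
    by (intro provesI) auto
qed

lemma precomplex_arith_model:
  assumes v: "model v"
  shows "in_model v precomplex_arith"
proof (intro precomplex_arith.intro precomplex_zero_model v precomplex_arith_axioms.intro)
  fix s assume "s \<in> set_cl v (Cst KRR)"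
  then show "op_cl v (Cst KTimes) s (cl v (Cst KZero)) = cl v (Cst KZero)"
    using model_proves[OF v mul_zero] v by (elim set_clE[OF v]) (simp add: cl_simps[OF v])
qed (use model_proves[OF v one_add_zero] in \<open>simp add: cl_simps[OF v]\<close>)

section \<open>Values of arithmetic terms\<close>

primrec emb :: "arith_term \<Rightarrow> trm" where
  "emb Zero = Cst KZero"
| "emb One = Cst KOne"
| "emb Two = Cst KTwo"
| "emb Three = Cst KThree"
| "emb Four = Cst KFour"
| "emb Five = Cst KFive"
| "emb Six = Cst KSix"
| "emb Seven = Cst KSeven"
| "emb Eight = Cst KEight"
| "emb Nine = Cst KNine"
| "emb Ten = Cst KTen"
| "emb (Plus s t) = Opv (emb s) (Cst KPlus) (emb t)"
| "emb (Times s t) = Opv (emb s) (Cst KTimes) (emb t)"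

lemma tstr_emb: "tstr (emb t) = term_str t"
  by (induction t) (simp_all add: plus_str_def times_str_def)

lemma model_eval:
  assumes v: "model v"
  shows "cl v (emb t) = precomplex_arith.nat_in (op_cl v (Cst KPlus)) (cl v (Cst KZero)) (cl v (Cst KOne)) (val t)"
proof -
  interpret M: precomplex_arith "op_cl v (Cst KPlus)" "op_cl v (Cst KTimes)" "cl v (Cst KZero)"
    "cl v (Cst KOne)" "cl v (Cst KI)" "set_cl v (Cst KCC)" "set_cl v (Cst KRR)" "rel_cl v (Cst KLess)"
    by (rule precomplex_arith_model[OF v])
  have suc: "cl v k = M.nat_in (Suc n)"
    if "v (Eq k (Opv l (Cst KPlus) (Cst KOne)))" "cl v l = M.nat_in n" for k l n
    using that op_cl[OF v, of "Cst KPlus" l "Cst KOne"] by (simp add: cl_simps[OF v])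
  have one: "cl v (Cst KOne) = M.nat_in (Suc 0)" by (simp only: M.nat_in_one)
  note two = suc[OF model_proves[OF v df_two] one]
  note three = suc[OF model_proves[OF v df_three] two]
  note four = suc[OF model_proves[OF v df_four] three]
  note five = suc[OF model_proves[OF v df_five] four]
  note six = suc[OF model_proves[OF v df_six] five]
  note seven = suc[OF model_proves[OF v df_seven] six]
  note eight = suc[OF model_proves[OF v df_eight] seven]
  note nine = suc[OF model_proves[OF v df_nine] eight]
  note ten = suc[OF model_proves[OF v df_ten] nine]
  show ?thesis
  proof (induction t)
    case (Plus s t)
    then show ?case by (simp add: M.nat_in_add flip: op_cl[OF v])
  next
    case (Times s t)
    then show ?case by (simp add: M.nat_in_mul flip: op_cl[OF v])
  qed (use one two three four five six seven eight nine ten in \<open>simp_all add: eval_nat_numeral del: M.nat_in.simps(2)\<close>)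
qed

text \<open>In every valuation the two equations put \<open>a\<close> and \<open>b\<close> into the
  classes of \<open>emb m\<close> and \<open>emb n\<close>. The operations on classes therefore
  evaluate the right-hand side to the value of \<open>t\<close>.\<close>

lemma proves_mult_add:
  assumes "val t = val m * val p + val n"
    and "proves (Eq (emb m) a)" and "proves (Eq (emb n) b)"
  shows "proves (Eq (emb t) (Opv (Opv a (Cst KTimes) (emb p)) (Cst KPlus) b))"
proof (rule provesI)
  fix v assume v: "model v"
  interpret M: precomplex_arith "op_cl v (Cst KPlus)" "op_cl v (Cst KTimes)" "cl v (Cst KZero)"
    "cl v (Cst KOne)" "cl v (Cst KI)" "set_cl v (Cst KCC)" "set_cl v (Cst KRR)" "rel_cl v (Cst KLess)"
    by (rule precomplex_arith_model[OF v])
  have "cl v a = cl v (emb m)" "cl v b = cl v (emb n)"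
    using model_proves[OF v assms(2)] model_proves[OF v assms(3)] by (simp_all add: cl_eq_iff[OF v] model_eq_sym[OF v])
  then have "cl v (emb t) = cl v (Opv (Opv a (Cst KTimes) (emb p)) (Cst KPlus) b)"
    using assms(1) by (simp add: model_eval[OF v] M.nat_in_add M.nat_in_mul flip: op_cl[OF v])
  then show "v (Eq (emb t) (Opv (Opv a (Cst KTimes) (emb p)) (Cst KPlus) b))"
    by (simp add: cl_eq_iff[OF v])
qed

end

section \<open>Numerals and dummy variables\<close>

text \<open>Last digit and prefix are remainder and quotient modulo 4. The condition
  \<open>val n \<noteq> 0\<close> rules out leading zeros, so a composite numeral has value at least
  4 and cannot coincide with a digit.\<close>

lemma numeral_term_inj:
  "numeral_term s \<Longrightarrow> numeral_term t \<Longrightarrow> val s = val t \<Longrightarrow> s = t"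
proof (induction s arbitrary: t rule: numeral_term.induct)
  case (digit a)
  from digit(2) show ?case
    by cases (use digit(1,3) in auto)
next
  case (step n a)
  from step(5) show ?case
  proof cases
    case digit
    then show ?thesis using step(2,3,6) by auto
  next
    case (step n' a')
    then have "4 * val n + val a = 4 * val n' + val a'" "val a < 4" "val a' < 4"
      using step.hyps step.prems by auto
    then have "val n = val n'" "val a = val a'" by presburger+
    with step.IH[OF step(2)] step step.hyps show ?thesis by auto
  qed
qed

lemma numeral_term_exists: "\<exists>t. numeral_term t \<and> val t = k"
proof (induction k rule: less_induct)
  case (less k)
  have digit_ex: "\<exists>a \<in> {Zero, One, Two, Three}. val a = r" if "r < 4" for r
  proof -
    from that have "r = 0 \<or> r = 1 \<or> r = 2 \<or> r = 3" by auto
    then show ?thesis by auto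
  qed
  show ?case
  proof (cases "k < 4")
    case True
    then show ?thesis using digit_ex numeral_term.digit by blast
  next
    case False
    then have "k div 4 < k" by simp
    from less.IH[OF this] obtain n where n: "numeral_term n" "val n = k div 4" by auto
    have "k mod 4 < 4" by simp
    from digit_ex[OF this] obtain a where a: "a \<in> {Zero, One, Two, Three}" "val a = k mod 4"
      by (rule bexE)
    have "numeral_term (Plus (Times Four n) a)"
      using n a False by (intro numeral_term.step) auto
    then show ?thesis using n a by (intro exI[of _ "Plus (Times Four n) a"]) simp
  qed
qed

lemma val_numeral_of: "val (numeral_of x) = val x"
proof -
  have "\<exists>!t. numeral_term t \<and> val t = val x"
    using numeral_term_exists numeral_term_inj by metis
  from theI'[OF this] show ?thesis by (simp add: numeral_of_def)
qed

fun var_index :: "mvar \<Rightarrow> nat" where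
  "var_index (WffVar i) = i"
| "var_index (SetVar i) = i"
| "var_index (ClassVar i) = i"

fun shift_var :: "nat \<Rightarrow> mvar \<Rightarrow> mvar" where
  "shift_var N (WffVar i) = WffVar (N + i)"
| "shift_var N (SetVar i) = SetVar (N + i)"
| "shift_var N (ClassVar i) = ClassVar (N + i)"

text \<open>
  The dummy variables of one proof may occur in the statement of another one, so they are moved out
  of the way before the restrictions of two proofs are united.
\<close>

lemma provable_fresh_dummies:
  assumes "provable \<Gamma> dv e" and "expr_vars e \<subseteq> T" and "\<And>v. v \<in> T \<Longrightarrow> var_index v < N"
  obtains D where "derivable \<Gamma> D e"
    and "\<And>x y. \<lbrakk>x \<in> T; y \<in> T; x \<noteq> y; {x, y} \<in> D\<rbrakk> \<Longrightarrow> {x, y} \<in> dv"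
proof -
  obtain D where D: "derivable \<Gamma> D e"
    and dv: "\<And>x y. \<lbrakk>x \<in> expr_vars e; y \<in> expr_vars e; x \<noteq> y; {x, y} \<in> D\<rbrakk> \<Longrightarrow> {x, y} \<in> dv"
    using assms(1) by (auto simp: provable_def)
  \<comment> \<open>The variables of \<open>e\<close> stay fixed and have index below
    \<open>N\<close>; all others move to an index of at least \<open>N\<close>. Hence
    \<open>\<rho>\<close> is injective and sends every dummy outside \<open>T\<close>.\<close>
  define \<rho> where "\<rho> v = (if v \<in> expr_vars e then v else shift_var N v)" for v
  have ge: "\<not> var_index (shift_var N v) < N" for v by (cases v) auto
  have inj_shift: "shift_var N u = shift_var N v \<Longrightarrow> u = v" for u v by (cases u; cases v) auto
  have inj: "inj \<rho>"
    using ge inj_shift assms(2,3) unfolding inj_def \<rho>_def by (metis subsetD)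
  have "derivable \<Gamma> ((`) \<rho> ` D) (subst_expr (\<lambda>v. [X (\<rho> v)]) e)"
  proof (rule derivable_rename[OF D inj])
    show "var_type (\<rho> v) = var_type v" for v by (cases v) (auto simp: \<rho>_def)
  qed auto
  moreover have "subst_expr (\<lambda>v. [X (\<rho> v)]) e = e"
    by (rule subst_expr_fixed) (simp add: \<rho>_def)
  moreover have "{x, y} \<in> dv" if xy: "x \<in> T" "y \<in> T" "x \<noteq> y" "{x, y} \<in> (`) \<rho> ` D" for x y
  proof -
    obtain d where d: "d \<in> D" "\<rho> ` d = {x, y}" using xy(4) by auto
    have "v \<in> expr_vars e \<and> \<rho> v = v" if "v \<in> d" for v
      using that d(2) xy(1,2) assms(3) ge \<rho>_def by (metis imageI insertE singletonD)
    then have "d = {x, y}" "d \<subseteq> expr_vars e"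
      using d(2) by force+
    then show ?thesis using dv[of x y] d(1) xy(3) by auto
  qed
  ultimately show ?thesis using that[of "(`) \<rho> ` D"] by simp
qed

lemma str_vars_term_str: "str_vars (term_str t) = {}"
  by (induction t) (simp_all add: plus_str_def times_str_def)

lemma finite_str_vars: "finite (str_vars s)"
proof -
  have "X ` str_vars s \<subseteq> set s" by (auto simp: str_vars_def)
  then show ?thesis by (meson List.finite_set finite_imageD finite_subset inj_onI sym.inject(2))
qed

theorem theorem10:
  fixes \<Gamma> :: "assertion set" and dv :: "mvar set set"
    and m n p :: arith_term and m' n' :: "sym list"
  assumes "set_mm_database \<Gamma>"
    and "numeral_term m" and "numeral_term n"
    and "p \<in> {Zero, One, Two, Three}"
    and "is_term \<Gamma> m'" and "is_term \<Gamma> n'"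
    and "provable \<Gamma> dv (eq_thm (term_str m) m')"
    and "provable \<Gamma> dv (eq_thm (term_str n) n')"
  shows "provable \<Gamma> dv
    (eq_thm (term_str (numeral_of (Plus (Times m p) n)))
            (plus_str (times_str m' (term_str p)) n'))"
proof -
  define T where "T = str_vars m' \<union> str_vars n'"
  have "finite T" by (simp add: T_def finite_str_vars)
  then obtain N where N: "\<And>v. v \<in> T \<Longrightarrow> var_index v < N"
    using finite_nat_set_iff_bounded[of "var_index ` T"] by auto
  have vars: "expr_vars (eq_thm (term_str m) m') \<subseteq> T" "expr_vars (eq_thm (term_str n) n') \<subseteq> T"
    by (auto simp: T_def eq_thm_def expr_vars_def str_vars_term_str)
  obtain D\<^sub>1 where D\<^sub>1: "derivable \<Gamma> D\<^sub>1 (eq_thm (term_str m) m')"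
    and dv\<^sub>1: "\<And>x y. \<lbrakk>x \<in> T; y \<in> T; x \<noteq> y; {x, y} \<in> D\<^sub>1\<rbrakk> \<Longrightarrow> {x, y} \<in> dv"
    using provable_fresh_dummies[OF assms(7) vars(1) N] by metis
  obtain D\<^sub>2 where D\<^sub>2: "derivable \<Gamma> D\<^sub>2 (eq_thm (term_str n) n')"
    and dv\<^sub>2: "\<And>x y. \<lbrakk>x \<in> T; y \<in> T; x \<noteq> y; {x, y} \<in> D\<^sub>2\<rbrakk> \<Longrightarrow> {x, y} \<in> dv"
    using provable_fresh_dummies[OF assms(8) vars(2) N] by metis
  \<comment> \<open>The added pairs make every variable outside \<open>T\<close> available as a
    dummy. Since \<open>T\<close> is exactly the set of variables of the conclusion, they contribute
    no restriction to the statement proved.\<close>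
  define D where "D = D\<^sub>1 \<union> D\<^sub>2 \<union> {{x, y} | x y. x \<notin> T}"
  define atom where "atom b = (if b then m' else n')" for b
  have fresh: "SetVar (N + x) \<notin> T" for x using N[of "SetVar (N + x)"] by auto
  interpret embedding \<Gamma> D N atom
  proof
    show "set_mm_base \<subseteq> \<Gamma>" using assms(1) by (simp add: set_mm_database_def)
    show "derivable \<Gamma> D (Class, atom b)" for b
      using assms(5,6) by (auto simp: atom_def is_term_def intro: derivable_mono)
    show "SetVar (N + x) \<notin> str_vars (atom b)" for b x
      using fresh[of x] by (auto simp: T_def atom_def)
    show "{SetVar (N + x), v} \<in> D" for x v
      using fresh[of x] by (auto simp: D_def)
  qed
  have sub: "D\<^sub>1 \<subseteq> D" "D\<^sub>2 \<subseteq> D" by (auto simp: D_def)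
  have "proves (Eq (emb m) (Atom True))" "proves (Eq (emb n) (Atom False))"
    using derivable_mono[OF D\<^sub>1 sub(1)] derivable_mono[OF D\<^sub>2 sub(2)]
    by (simp_all add: proves_def tstr_emb atom_def eq_thm_def)
  then have "proves (Eq (emb (numeral_of (Plus (Times m p) n)))
      (Opv (Opv (Atom True) (Cst KTimes) (emb p)) (Cst KPlus) (Atom False)))"
    by (intro proves_mult_add) (simp_all add: val_numeral_of)
  then have "derivable \<Gamma> D (eq_thm (term_str (numeral_of (Plus (Times m p) n)))
      (plus_str (times_str m' (term_str p)) n'))"
    by (simp add: proves_def tstr_emb atom_def eq_thm_def plus_str_def times_str_def)
  moreover have "{x, y} \<in> dv" if "x \<in> T" "y \<in> T" "x \<noteq> y" "{x, y} \<in> D" for x y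
    using that dv\<^sub>1 dv\<^sub>2 by (auto simp: D_def doubleton_eq_iff)
  moreover have "expr_vars (eq_thm (term_str (numeral_of (Plus (Times m p) n)))
      (plus_str (times_str m' (term_str p)) n')) = T"
    by (simp add: T_def eq_thm_def plus_str_def times_str_def expr_vars_def str_vars_term_str)
  ultimately show ?thesis unfolding provable_def by metis
qed

end
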